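(* Let $\mathcal{C}\subset\mathbb{Z}^n$ be a circuit and let $N$ be the number of real solutions of a generic real polynomial system supported on $\mathcal{C}$. Then: (1) if $\mathrm{rk}(\bar{\mathcal{C}})\le m(\mathcal{C})$, then $N\le 2^{\,n-\mathrm{rk}(\bar{\mathcal{C}})}\big(m(\mathcal{C})+\mathrm{rk}(\bar{\mathcal{C}})+1\big)$; (2) if $\mathrm{rk}(\bar{\mathcal{C}})\ge m(\mathcal{C})$, then $N\le 2^{\,n-\mathrm{rk}(\bar{\mathcal{C}})}\big(2m(\mathcal{C})+1\big)$.
   Context: A circuit is a set $\mathcal{C}\subset\mathbb{Z}^n$ of $n+2$ points whose affine span is $\mathbb{R}^n$; it contains a unique minimal affinely dependent subset, and $m(\mathcal{C})$ denotes the dimension of the affine span of that subset (so $1\le m(\mathcal{C})\le n$). The rank modulo $2$ of $\mathcal{C}$, $\mathrm{rk}(\bar{\mathcal{C}})$, is the rank over $\mathbb{Z}/2$ of the matrix whose columns are the reductions modulo $2$ of the vectors $w-w'$, $w\in\mathcal{C}$, for a fixed $w'\in\mathcal{C}$ (equivalently, after translating $\mathcal{C}$ so that $0\in\mathcal{C}$, of the nonzero elements of $\mathcal{C}$). A real polynomial system supported on $\mathcal{C}$ is a system of $n$ Laurent polynomial equations $F_1=\dots=F_n=0$ in $x=(x_1,\dots,x_n)$ with real coefficients, where each $F_j$ has support $\mathcal{C}$ (the set of exponent vectors of its monomials with nonzero coefficient). Such a system is generic if its number of solutions in $(\mathbb{C}^* )^n$ equals the normalized volume $v(\mathcal{C})$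 of the convex hull of $\mathcal{C}$ (normalized so that $[0,1]^n$ has volume $n!$). Real solutions are solutions in $(\mathbb{R}^* )^n$. *)

theory Defs
  imports "HOL-Analysis.Analysis" "HOL-Library.Z2"
begin

definition rvec :: "int ^ 'n \<Rightarrow> real ^ 'n" where
  "rvec w = (\<chi> i. real_of_int (w $ i))"

definition is_circuit :: "(int ^ 'n::finite) set \<Rightarrow> bool" where
  "is_circuit C \<longleftrightarrow> finite C \<and> card C = CARD('n) + 2 \<and>
     affine hull (rvec ` C) = UNIV"

definition min_dep_subset :: "(int ^ 'n::finite) set \<Rightarrow> (int ^ 'n) set" where
  "min_dep_subset C = (THE D. D \<subseteq> C \<and> affine_dependent (rvec ` D) \<and>
      (\<forall>D'. D' \<subset> D \<longrightarrow> \<not> affine_dependent (rvec ` D')))"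

definition m_circ :: "(int ^ 'n::finite) set \<Rightarrow> nat" where
  "m_circ C = nat (aff_dim (rvec ` min_dep_subset C))"

definition rk_mod2 :: "(int ^ 'n::finite) set \<Rightarrow> nat" where
  "rk_mod2 C = (let w' = (SOME w'. w' \<in> C) in
     vec.dim ((\<lambda>w. (\<chi> i. (of_int (w $ i - w' $ i) :: bit))) ` C))"

definition norm_vol :: "(int ^ 'n::finite) set \<Rightarrow> real" where
  "norm_vol C = fact CARD('n) * measure lebesgue (convex hull (rvec ` C))"

definition laurent_eval ::
  "(int ^ 'n::finite \<Rightarrow> real) \<Rightarrow> (int ^ 'n) set \<Rightarrow> 'a::real_normed_field ^ 'n \<Rightarrow> 'a" where
  "laurent_eval c C x = (\<Sum>w\<in>C. of_real (c w) * (\<Prod>i\<in>UNIV. (x $ i) powi (w $ i)))"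

definition torus_solutions ::
  "('n::finite \<Rightarrow> int ^ 'n \<Rightarrow> real) \<Rightarrow> (int ^ 'n) set \<Rightarrow> ('a::real_normed_field ^ 'n) set" where
  "torus_solutions c C = {x. (\<forall>i. x $ i \<noteq> 0) \<and> (\<forall>j. laurent_eval (c j) C x = 0)}"

definition supported_on :: "('n::finite \<Rightarrow> int ^ 'n \<Rightarrow> real) \<Rightarrow> (int ^ 'n) set \<Rightarrow> bool" where
  "supported_on c C \<longleftrightarrow> (\<forall>j w. c j w \<noteq> 0 \<longleftrightarrow> w \<in> C)"

definition generic_system :: "('n::finite \<Rightarrow> int ^ 'n \<Rightarrow> real) \<Rightarrow> (int ^ 'n) set \<Rightarrow> bool" where
  "generic_system c C \<longleftrightarrow> finite (torus_solutions c C :: (complex ^ 'n) set) \<and>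
     real (card (torus_solutions c C :: (complex ^ 'n) set)) = norm_vol C"

end

theory Submission
  imports Defs "HOL-Complex_Analysis.Great_Picard"
begin

text \<open>
  Finiteness of the complex solutions forces the coefficient matrix to have a kernel of dimension
  at most two, so the monomials of a solution are, up to a common factor, linear forms
  \<open>1 + y * a w\<close> in one real parameter \<open>y\<close>. The solutions over a fixed \<open>y\<close> differ by signs that are
  trivial on the exponents modulo 2, so there are at most \<open>2 ^ (n - rk)\<close> of them. The admissible \<open>y\<close>
  are zeros of \<open>\<Sum>w. l w * ln \<bar>1 + y * a w\<bar>\<close> for the affine relation \<open>l\<close>, which involves \<open>m + 2\<close>
  forms. By Rolle there are at most \<open>m\<close> more of them than intervals (cut out by the roots of these
  forms) that contain an admissible \<open>y\<close>. The sign vectors on these intervals lie in an affine space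
  over the field with two elements of dimension at most \<open>min m rk\<close>, and sign vectors along the line
  are affinely independent; hence there are at most \<open>min m rk + 1\<close> such intervals.
\<close>

section \<open>The affine relation of a circuit\<close>

lemma common_denominator:
  fixes f :: "'a \<Rightarrow> rat"
  assumes "finite A"
  shows "\<exists>d::int. d \<noteq> 0 \<and> (\<forall>x\<in>A. \<exists>k::int. of_int d * f x = of_int k)"
  using assms
proof (induction A)
  case empty
  show ?case by (rule exI[of _ 1]) simp
next
  case (insert a A)
  then obtain d :: int where d: "d \<noteq> 0" "\<forall>x\<in>A. \<exists>k::int. of_int d * f x = of_int k" by blast
  obtain p q where "quotient_of (f a) = (p, q)" by fastforce
  then have q: "q \<noteq> 0" "f a = of_int p / of_int q"
    using quotient_of_denom_pos[of "f a" p q] quotient_of_div[of "f a" p q] by auto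
  have "\<exists>k::int. of_int (d * q) * f x = of_int k" if x: "x \<in> A" for x
  proof -
    obtain k :: int where k: "of_int d * f x = of_int k" using d(2) x by blast
    have "of_int (d * q) * f x = of_int q * (of_int d * f x)" by (simp only: of_int_mult ac_simps)
    also have "\<dots> = of_int (q * k)" using k by simp
    finally show ?thesis by (rule exI)
  qed
  moreover have "of_int (d * q) * f a = of_int (d * p)" using q by simp
  ultimately have "\<forall>x\<in>insert a A. \<exists>k::int. of_int (d * q) * f x = of_int k" by blast
  then show ?case using d q by (intro exI[of _ "d * q"]) auto
qed

text \<open>Subtracting one point of \<open>C\<close> leaves more vectors than the dimension of the
  rational space they lie in; a linear dependence among them is cleared of denominators.\<close>

lemma integer_affine_relation:
  fixes C :: "(int ^ 'n::finite) set"
  assumes fin: "finite C" and card: "card C > CARD('n) + 1"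
  shows "\<exists>l :: int ^ 'n \<Rightarrow> int. (\<Sum>w\<in>C. l w) = 0 \<and> (\<forall>i. (\<Sum>w\<in>C. l w * w $ i) = 0) \<and> (\<exists>w\<in>C. l w \<noteq> 0)"
proof -
  obtain w0 where w0: "w0 \<in> C" using card by fastforce
  define f :: "int ^ 'n \<Rightarrow> rat ^ 'n" where "f w = (\<chi> i. of_int (w $ i - w0 $ i))" for w
  have inj: "inj_on f A" for A
    by (rule inj_onI) (simp add: f_def vec_eq_iff)
  define A where "A = C - {w0}"
  have finA: "finite A" using fin by (simp add: A_def)
  have "card (f ` A) > CARD('n)"
    using card w0 fin by (simp add: card_image[OF inj] A_def)
  moreover have "vec.dim (f ` A) \<le> CARD('n)"
    by (metis vec.dim_subset_UNIV vec_dim_card vec.dimension_def card_cart_basis)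
  ultimately have "vec.dependent (f ` A)"
    by (intro vec.dependent_biggerset_general) simp
  then obtain u where u: "\<exists>v\<in>f ` A. u v \<noteq> 0" "(\<Sum>v\<in>f ` A. u v *s v) = 0"
    using vec.dependent_finite[of "f ` A"] finA by auto
  define \<mu> where "\<mu> w = u (f w)" for w
  have mu: "(\<Sum>w\<in>A. \<mu> w * of_int (w $ i - w0 $ i)) = 0" for i
  proof -
    have "(\<Sum>v\<in>f ` A. u v *s v) $ i = (\<Sum>w\<in>A. \<mu> w * f w $ i)"
      by (simp add: sum.reindex[OF inj] \<mu>_def)
    then have "(\<Sum>w\<in>A. \<mu> w * f w $ i) = 0" unfolding u(2) by simp
    then show ?thesis by (simp add: f_def)
  qed
  obtain d :: int where d: "d \<noteq> 0" "\<forall>x\<in>A. \<exists>k::int. of_int d * \<mu> x = of_int k"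
    using common_denominator[OF finA] by blast
  then obtain k :: "int ^ 'n \<Rightarrow> int" where k: "\<And>x. x \<in> A \<Longrightarrow> of_int d * \<mu> x = of_int (k x)"
    by metis
  have k0: "(\<Sum>w\<in>A. k w * (w $ i - w0 $ i)) = 0" for i
  proof -
    have "of_int (\<Sum>w\<in>A. k w * (w $ i - w0 $ i)) = (\<Sum>w\<in>A. of_int d * \<mu> w * (of_int (w $ i - w0 $ i)::rat))"
      using k by simp
    also have "\<dots> = of_int d * (\<Sum>w\<in>A. \<mu> w * of_int (w $ i - w0 $ i))"
      by (simp add: sum_distrib_left mult.assoc)
    finally show ?thesis using mu by (metis mult_zero_right of_int_eq_0_iff)
  qed
  \<comment> \<open>The total being zero forces the coefficient at \<open>w0\<close>, which turns
    the relation between differences into an affine one.\<close>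
  define l where "l w = (if w = w0 then - sum k A else k w)" for w
  have C: "C = insert w0 A" "w0 \<notin> A" using w0 by (auto simp: A_def)
  have lA: "(\<Sum>w\<in>A. g (l w) w) = (\<Sum>w\<in>A. g (k w) w)" for g :: "int \<Rightarrow> int ^ 'n \<Rightarrow> int"
    using C by (intro sum.cong) (auto simp: l_def)
  have "(\<Sum>w\<in>C. l w) = 0"
    unfolding C(1) using finA C(2) lA[of "\<lambda>x _. x"] by (simp add: l_def)
  moreover have "(\<Sum>w\<in>C. l w * w $ i) = 0" for i
    unfolding C(1) using finA C(2) lA[of "\<lambda>x w. x * w $ i"] k0[of i]
    by (simp add: l_def[of w0] algebra_simps sum_subtractf sum_distrib_left)
  moreover have "\<exists>w\<in>C. l w \<noteq> 0"
  proof -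
    obtain x where x: "x \<in> A" "\<mu> x \<noteq> 0" using u by (auto simp: \<mu>_def)
    then have "k x \<noteq> 0" using k[of x] d by auto
    then show ?thesis using x C by (intro bexI[of _ x]) (auto simp: l_def)
  qed
  ultimately show ?thesis by blast
qed

text \<open>A nonzero relation with the least sum of absolute values cannot be entirely even, since
  halving it would give a smaller one. Oddness keeps the relation nontrivial modulo 2.\<close>

lemma odd_integer_affine_relation:
  fixes C :: "(int ^ 'n::finite) set"
  assumes fin: "finite C" and card: "card C > CARD('n) + 1"
  shows "\<exists>l :: int ^ 'n \<Rightarrow> int. (\<Sum>w\<in>C. l w) = 0 \<and> (\<forall>i. (\<Sum>w\<in>C. l w * w $ i) = 0) \<and> (\<exists>w\<in>C. odd (l w))"
proof -
  define P :: "(int ^ 'n \<Rightarrow> int) \<Rightarrow> bool" where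
    "P l \<longleftrightarrow> (\<Sum>w\<in>C. l w) = 0 \<and> (\<forall>i. (\<Sum>w\<in>C. l w * w $ i) = 0) \<and> (\<exists>w\<in>C. l w \<noteq> 0)" for l
  have "\<exists>l. P l" unfolding P_def by (rule integer_affine_relation[OF assms])
  then obtain l where l: "P l" and min: "\<And>l'. P l' \<Longrightarrow> (\<Sum>w\<in>C. nat \<bar>l w\<bar>) \<le> (\<Sum>w\<in>C. nat \<bar>l' w\<bar>)"
    using ex_has_least_nat[of P _ "\<lambda>l. \<Sum>w\<in>C. nat \<bar>l w\<bar>"] by metis
  have "\<exists>w\<in>C. odd (l w)"
  proof (rule ccontr)
    assume "\<not> ?thesis"
    then have ev: "l w = 2 * (l w div 2)" if "w \<in> C" for w using that by simp
    define h where "h w = l w div 2" for w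
    have lh: "l w = 2 * h w" if "w \<in> C" for w using ev[OF that] by (simp add: h_def)
    have "(\<Sum>w\<in>C. l w) = 2 * (\<Sum>w\<in>C. h w)"
      using lh by (simp add: sum_distrib_left)
    moreover have "(\<Sum>w\<in>C. l w * w $ i) = 2 * (\<Sum>w\<in>C. h w * w $ i)" for i
      using lh by (simp add: sum_distrib_left mult.assoc)
    ultimately have "P h" using l lh unfolding P_def by fastforce
    obtain w where w: "w \<in> C" "l w \<noteq> 0" using l by (auto simp: P_def)
    have "(\<Sum>w\<in>C. nat \<bar>h w\<bar>) < (\<Sum>w\<in>C. nat \<bar>l w\<bar>)"
    proof (rule sum_strict_mono_ex1[OF fin])
      show "\<forall>w\<in>C. nat \<bar>h w\<bar> \<le> nat \<bar>l w\<bar>" using lh by auto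
      show "\<exists>w\<in>C. nat \<bar>h w\<bar> < nat \<bar>l w\<bar>" using lh w by (intro bexI[of _ w]) auto
    qed
    then show False using min[OF \<open>P h\<close>] by simp
  qed
  then show ?thesis using l by (auto simp: P_def)
qed

locale circuit_relation =
  fixes C :: "(int ^ 'n::finite) set" and l :: "int ^ 'n \<Rightarrow> int"
  assumes circuit: "is_circuit C"
    and sum_l: "(\<Sum>w\<in>C. l w) = 0"
    and sum_l_nth: "(\<Sum>w\<in>C. l w * w $ i) = 0"
    and odd_l: "\<exists>w\<in>C. odd (l w)"

lemma circuit_relation_exists:
  fixes C :: "(int ^ 'n::finite) set"
  assumes "is_circuit C"
  shows "\<exists>l. circuit_relation C l"
  using odd_integer_affine_relation[of C] assms
  by (auto simp: circuit_relation_def is_circuit_def)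

lemma inj_rvec: "inj_on rvec A"
  by (rule inj_onI) (simp add: rvec_def vec_eq_iff)

text \<open>Injectivity of \<open>rvec\<close> allows coefficients to be indexed by lattice points
  and the vector equation to be read coordinatewise.\<close>

lemma affine_dependent_rvec_iff:
  fixes A :: "(int ^ 'n::finite) set"
  assumes "finite A"
  shows "affine_dependent (rvec ` A) \<longleftrightarrow>
    (\<exists>\<mu>. (\<Sum>w\<in>A. \<mu> w) = 0 \<and> (\<forall>i. (\<Sum>w\<in>A. \<mu> w * real_of_int (w $ i)) = 0) \<and> (\<exists>w\<in>A. \<mu> w \<noteq> 0))"
    (is "?L \<longleftrightarrow> ?R")
proof
  assume ?L
  then obtain U where U: "sum U (rvec ` A) = 0" "\<exists>v\<in>rvec ` A. U v \<noteq> 0"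
    "(\<Sum>v\<in>rvec ` A. U v *\<^sub>R v) = 0"
    using affine_dependent_explicit_finite[of "rvec ` A"] assms by auto
  have "(\<Sum>v\<in>rvec ` A. U v *\<^sub>R v) $ i = (\<Sum>w\<in>A. U (rvec w) * real_of_int (w $ i))" for i
    by (simp add: sum.reindex[OF inj_rvec]) (simp add: rvec_def)
  then have "(\<Sum>w\<in>A. U (rvec w) * real_of_int (w $ i)) = 0" for i
    using U(3) by simp
  then show ?R using U(1,2)
    by (intro exI[of _ "U \<circ> rvec"]) (auto simp: sum.reindex[OF inj_rvec])
next
  assume ?R
  then obtain \<mu> where m: "(\<Sum>w\<in>A. \<mu> w) = 0" "\<And>i. (\<Sum>w\<in>A. \<mu> w * real_of_int (w $ i)) = 0"
    "\<exists>w\<in>A. \<mu> w \<noteq> 0" by blast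
  define U where "U v = \<mu> (the_inv_into A rvec v)" for v
  have U: "U (rvec w) = \<mu> w" if "w \<in> A" for w
    using the_inv_into_f_f[OF inj_rvec that] by (simp add: U_def)
  have "(\<Sum>v\<in>rvec ` A. U v *\<^sub>R v) $ i = 0" for i
    using m(2)[of i] by (simp add: sum.reindex[OF inj_rvec] U) (simp add: rvec_def)
  then have "(\<Sum>v\<in>rvec ` A. U v *\<^sub>R v) = 0" by (simp add: vec_eq_iff)
  moreover have "sum U (rvec ` A) = 0" using m by (simp add: sum.reindex[OF inj_rvec] U)
  moreover have "\<exists>v\<in>rvec ` A. U v \<noteq> 0" using m U by auto
  ultimately show ?L using affine_dependent_explicit_finite[of "rvec ` A"] assms by blast
qed

section \<open>The support of the relation as the minimal dependent subset\<close>

context circuit_relation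
begin

definition D :: "(int ^ 'n) set" where "D = {w \<in> C. l w \<noteq> 0}"

lemma finite_C: "finite C" and card_C: "card C = CARD('n) + 2"
  and hull_C: "affine hull (rvec ` C) = UNIV"
  using circuit by (auto simp: is_circuit_def)

lemma D_subset: "D \<subseteq> C" by (auto simp: D_def)

lemma finite_D: "finite D" using D_subset finite_C finite_subset by blast

lemma D_nonempty: "D \<noteq> {}" using odd_l by (auto simp: D_def)

lemma exists_redundant_point:
  "\<exists>w0\<in>C. \<not> affine_dependent (rvec ` (C - {w0}))"
proof -
  obtain B where B: "B \<subseteq> rvec ` C" "\<not> affine_dependent B" "affine hull (rvec ` C) = affine hull B"
    using affine_basis_exists by metis
  have "int (card B) = aff_dim B + 1" using B aff_dim_affine_independent by blast
  moreover have "aff_dim B = int CARD('n)"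
    using B hull_C by (metis aff_dim_UNIV aff_dim_affine_hull DIM_cart DIM_real mult_1_right)
  ultimately have cB: "card B = CARD('n) + 1" by simp
  have "card (rvec ` C - B) = 1"
    using B finite_C cB card_C by (simp add: card_Diff_subset finite_subset card_image[OF inj_rvec])
  then obtain v where v: "rvec ` C - B = {v}" by (meson card_1_singletonE)
  then obtain w0 where w0: "w0 \<in> C" "v = rvec w0" by blast
  have "rvec ` (C - {w0}) \<subseteq> B"
  proof
    fix x assume "x \<in> rvec ` (C - {w0})"
    then have "x \<noteq> v" "x \<in> rvec ` C" using w0 inj_rvec[of UNIV] by (auto dest: injD)
    then show "x \<in> B" using v by blast
  qed
  then show ?thesis using w0 B(2) affine_dependent_subset by blast
qed

text \<open>A relation vanishing at the redundant point \<open>w0\<close> relates independent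
  points, hence is zero. So all relations are multiples of \<open>l\<close>, and one that vanishes
  where \<open>l\<close> does not is trivial.\<close>

lemma relation_unique:
  assumes s: "(\<Sum>w\<in>C. \<mu> w) = 0" and si: "\<And>i. (\<Sum>w\<in>C. \<mu> w * real_of_int (w $ i)) = 0"
    and w1: "w1 \<in> D" "\<mu> w1 = 0" and w: "w \<in> C"
  shows "\<mu> w = 0"
proof -
  obtain w0 where w0: "w0 \<in> C" "\<not> affine_dependent (rvec ` (C - {w0}))"
    using exists_redundant_point by blast
  have *: "\<nu> w = 0" if n: "(\<Sum>w\<in>C. \<nu> w) = 0" "\<And>i. (\<Sum>w\<in>C. \<nu> w * real_of_int (w $ i)) = 0"
    "\<nu> w0 = 0" and w: "w \<in> C" for \<nu> w
  proof -
    have "(\<Sum>w\<in>C - {w0}. \<nu> w) = 0" "\<And>i. (\<Sum>w\<in>C - {w0}. \<nu> w * real_of_int (w $ i)) = 0"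
      using n sum.remove[OF finite_C w0(1), of \<nu>]
        sum.remove[OF finite_C w0(1), of "\<lambda>w. \<nu> w * real_of_int (w $ _)"] by auto
    then have "\<nu> w = 0" if "w \<in> C - {w0}" for w
      using w0(2) that finite_C by (subst (asm) affine_dependent_rvec_iff) auto
    then show ?thesis using n w by blast
  qed
  have rl: "(\<Sum>w\<in>C. real_of_int (l w)) = 0" "\<And>i. (\<Sum>w\<in>C. real_of_int (l w) * real_of_int (w $ i)) = 0"
    using sum_l sum_l_nth by (simp_all flip: of_int_mult of_int_sum)
  have l0: "l w0 \<noteq> 0"
  proof
    assume "l w0 = 0"
    then have "real_of_int (l w1) = 0" using *[of "\<lambda>w. real_of_int (l w)" w1] rl w1 D_subset by auto
    then show False using w1 by (simp add: D_def)
  qed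
  \<comment> \<open>The combination of \<open>\<mu>\<close> and \<open>l\<close> that vanishes at
    \<open>w0\<close>.\<close>
  define \<nu> where "\<nu> w = \<mu> w * l w0 - l w * \<mu> w0" for w
  have nu0: "\<nu> w = 0" if "w \<in> C" for w
  proof (rule *[OF _ _ _ that])
    show "sum \<nu> C = 0" using s rl
      by (simp add: \<nu>_def sum_subtractf flip: sum_distrib_right)
    show "(\<Sum>w\<in>C. \<nu> w * real_of_int (w $ i)) = 0" for i
    proof -
      have "(\<Sum>w\<in>C. \<nu> w * real_of_int (w $ i)) = (\<Sum>w\<in>C. \<mu> w * real_of_int (w $ i)) * l w0 - (\<Sum>w\<in>C. real_of_int (l w) * real_of_int (w $ i)) * \<mu> w0"
        unfolding sum_distrib_right sum_subtractf[symmetric] by (rule sum.cong) (auto simp: \<nu>_def algebra_simps)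
      then show ?thesis using si rl by simp
    qed
  qed (simp add: \<nu>_def)
  have "\<mu> w0 = 0" using nu0[of w1] w1 D_subset by (auto simp: \<nu>_def D_def)
  then show ?thesis using *[OF s si] w by simp
qed

text \<open>A dependence avoiding \<open>w1\<close> extends by zero to a relation on
  \<open>C\<close> that vanishes at a point of \<open>D\<close>.\<close>

lemma independent_remove:
  assumes "w1 \<in> D"
  shows "\<not> affine_dependent (rvec ` (C - {w1}))"
proof
  assume "affine_dependent (rvec ` (C - {w1}))"
  then obtain \<mu> where m: "(\<Sum>w\<in>C - {w1}. \<mu> w) = 0" "\<And>i. (\<Sum>w\<in>C - {w1}. \<mu> w * real_of_int (w $ i)) = 0"
    "\<exists>w\<in>C - {w1}. \<mu> w \<noteq> 0"
    using affine_dependent_rvec_iff[of "C - {w1}"] finite_C by auto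
  have w1: "w1 \<in> C" using assms D_subset by auto
  define \<nu> where "\<nu> w = (if w = w1 then 0 else \<mu> w)" for w
  have "sum \<nu> C = 0" "\<And>i. (\<Sum>w\<in>C. \<nu> w * real_of_int (w $ i)) = 0"
    using m sum.remove[OF finite_C w1, of \<nu>]
        sum.remove[OF finite_C w1, of "\<lambda>w. \<nu> w * real_of_int (w $ _)"] by (auto simp: \<nu>_def)
  then have "\<nu> w = 0" if "w \<in> C" for w using relation_unique[of \<nu> w1 w] assms that by (simp add: \<nu>_def)
  moreover obtain w where "w \<in> C - {w1}" "\<mu> w \<noteq> 0" using m by blast
  ultimately show False using \<open>\<And>w. w \<in> C \<Longrightarrow> \<nu> w = 0\<close>[of w] by (auto simp: \<nu>_def)
qed

text \<open>Every dependent subset of \<open>C\<close> contains \<open>D\<close>, because omitting a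
  single point of \<open>D\<close> already leaves an independent set. So \<open>D\<close> is the
  least dependent subset.\<close>

lemma min_dep_subset_eq: "min_dep_subset C = D"
  unfolding min_dep_subset_def
proof (rule the_equality)
  have rl: "(\<Sum>w\<in>D. real_of_int (l w)) = 0" "\<And>i. (\<Sum>w\<in>D. real_of_int (l w) * real_of_int (w $ i)) = 0"
  proof -
    have "(\<Sum>w\<in>D. real_of_int (l w) * g w) = (\<Sum>w\<in>C. real_of_int (l w) * g w)" for g
      by (rule sum.mono_neutral_left) (auto simp: D_def finite_C)
    from this[of "\<lambda>_. 1"] this[of "\<lambda>w. real_of_int (w $ _)"]
    show "(\<Sum>w\<in>D. real_of_int (l w)) = 0" "\<And>i. (\<Sum>w\<in>D. real_of_int (l w) * real_of_int (w $ i)) = 0"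
      using sum_l sum_l_nth by (simp_all flip: of_int_mult of_int_sum)
  qed
  have dep: "affine_dependent (rvec ` D)"
    unfolding affine_dependent_rvec_iff[OF finite_D] using rl D_nonempty
    by (intro exI[of _ "\<lambda>w. real_of_int (l w)"]) (auto simp: D_def)
  have indep: "\<not> affine_dependent (rvec ` E)" if "w1 \<in> D" "w1 \<notin> E" "E \<subseteq> C" for w1 E
    using independent_remove[OF that(1)] affine_dependent_subset[of "rvec ` E" "rvec ` (C - {w1})"] that
    by blast
  show "D \<subseteq> C \<and> affine_dependent (rvec ` D) \<and> (\<forall>D'. D' \<subset> D \<longrightarrow> \<not> affine_dependent (rvec ` D'))"
    using D_subset dep indep by blast
  show "E = D" if "E \<subseteq> C \<and> affine_dependent (rvec ` E) \<and> (\<forall>D'. D' \<subset> E \<longrightarrow> \<not> affine_dependent (rvec ` D'))" for E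
    using indep dep that by blast
qed

text \<open>Removing one point from \<open>D\<close> leaves an independent set, whose size is at
  most its affine dimension plus one.\<close>

lemma card_D_le: "card D \<le> m_circ C + 2"
proof -
  obtain w1 where w1: "w1 \<in> D" using D_nonempty by blast
  have "\<not> affine_dependent (rvec ` (D - {w1}))"
    using independent_remove[OF w1] affine_dependent_subset[of "rvec ` (D - {w1})" "rvec ` (C - {w1})"] D_subset
    by blast
  then have "int (card (rvec ` (D - {w1}))) \<le> aff_dim (rvec ` D) + 1"
    by (intro independent_card_le_aff_dim) auto
  then have "int (card D) - 1 \<le> aff_dim (rvec ` D) + 1"
    using w1 finite_D by (simp add: card_image[OF inj_rvec])
  then show ?thesis unfolding m_circ_def min_dep_subset_eq by linarith
qed

text \<open>Exchange of summation. It applies to logarithms of monomials, which are affine functions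
  of the exponent \<open>w\<close>.\<close>

lemma relation_eq_0:
  "(\<Sum>w\<in>C. real_of_int (l w) * ((\<Sum>i\<in>UNIV. real_of_int (w $ i) * q i) + s)) = 0"
proof -
  have "(\<Sum>w\<in>C. real_of_int (l w) * ((\<Sum>i\<in>UNIV. real_of_int (w $ i) * q i) + s))
      = (\<Sum>w\<in>C. \<Sum>i\<in>UNIV. real_of_int (l w * w $ i) * q i) + (\<Sum>w\<in>C. real_of_int (l w)) * s"
    by (simp add: ring_distribs sum.distrib sum_distrib_left sum_distrib_right mult.assoc)
  also have "(\<Sum>w\<in>C. \<Sum>i\<in>UNIV. real_of_int (l w * w $ i) * q i) = (\<Sum>i\<in>UNIV. real_of_int (\<Sum>w\<in>C. l w * w $ i) * q i)"
    by (subst sum.swap) (simp add: sum_distrib_right)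
  also have "(\<Sum>w\<in>C. real_of_int (l w)) = 0" using sum_l by (simp flip: of_int_sum)
  finally show ?thesis by (simp add: sum_l_nth)
qed

text \<open>Converse of \<open>relation_eq_0\<close>: an affine function can interpolate
  \<open>h\<close> on the independent points other than \<open>w1\<close>, and the relation then
  forces the value at \<open>w1\<close> because \<open>l w1\<close> is nonzero. Exponentiating
  \<open>q\<close> yields torus points with prescribed monomials up to a common factor.\<close>

lemma lift_real:
  fixes h :: "int ^ 'n \<Rightarrow> real"
  assumes h: "(\<Sum>w\<in>C. real_of_int (l w) * h w) = 0"
  shows "\<exists>q s. \<forall>w\<in>C. (\<Sum>i\<in>UNIV. real_of_int (w $ i) * q i) + s = h w"
proof -
  obtain w1 where w1: "w1 \<in> D" using D_nonempty by blast
  have "card (C - {w1}) = CARD('n) + 1" using w1 D_subset finite_C card_C by auto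
  then obtain b where b: "b \<in> C - {w1}" by (metis all_not_in_conv card.empty add_is_0 one_neq_zero)
  define B where "B = C - {w1}"
  have bB: "b \<in> B" using b by (simp add: B_def)
  have "\<not> affine_dependent (rvec ` B)" using independent_remove[OF w1] by (simp add: B_def)
  then have "\<not> dependent ((\<lambda>x. -rvec b + x) ` (rvec ` B - {rvec b}))"
    using affine_dependent_iff_dependent2[of "rvec b" "rvec ` B"] bB by blast
  \<comment> \<open>A linear map with prescribed values on differences from the base point
    \<open>b\<close>; the constant \<open>s\<close> below makes it affine.\<close>
  then obtain f :: "real ^ 'n \<Rightarrow> real" where f: "linear f"
    "\<And>x. x \<in> (\<lambda>x. -rvec b + x) ` (rvec ` B - {rvec b}) \<Longrightarrow> f x = h (the_inv rvec (x + rvec b)) - h b"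
    using linear_independent_extend[of _ "\<lambda>x. h (the_inv rvec (x + rvec b)) - h b"] by metis
  have fB: "f (rvec w) - f (rvec b) = h w - h b" if "w \<in> B" for w
  proof (cases "w = b")
    case False
    then have "- rvec b + rvec w \<in> (\<lambda>x. -rvec b + x) ` (rvec ` B - {rvec b})"
      using that inj_rvec[of UNIV] by (auto dest: injD)
    then have "f (- rvec b + rvec w) = h w - h b"
      using f(2) by (simp add: the_inv_f_f[OF inj_rvec[of UNIV]])
    then show ?thesis using f(1) by (simp add: linear_diff)
  qed simp
  define q where "q i = f (axis i 1)" for i
  define s where "s = h b - f (rvec b)"
  have fq: "f (rvec w) = (\<Sum>i\<in>UNIV. real_of_int (w $ i) * q i)" for w
  proof -
    have "rvec w = (\<Sum>i\<in>UNIV. real_of_int (w $ i) *\<^sub>R axis i 1)"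
      by (simp add: vec_eq_iff rvec_def axis_def if_distrib cong: if_cong)
    then show ?thesis using f(1) by (simp add: linear_sum linear_cmul q_def)
  qed
  define k where "k w = (\<Sum>i\<in>UNIV. real_of_int (w $ i) * q i) + s" for w
  have kB: "k w = h w" if "w \<in> B" for w using fB[OF that] by (simp add: k_def s_def flip: fq)
  have "(\<Sum>w\<in>C. real_of_int (l w) * k w) = 0" unfolding k_def by (rule relation_eq_0)
  moreover have C: "C = insert w1 B" "w1 \<notin> B" "finite B" using w1 D_subset finite_C by (auto simp: B_def)
  ultimately have "real_of_int (l w1) * k w1 + (\<Sum>w\<in>B. real_of_int (l w) * h w) = 0"
    using kB by simp
  moreover have "real_of_int (l w1) * h w1 + (\<Sum>w\<in>B. real_of_int (l w) * h w) = 0"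
    using h C by simp
  ultimately have "real_of_int (l w1) * k w1 = real_of_int (l w1) * h w1" by linarith
  then have "k w1 = h w1" using w1 by (simp add: D_def)
  then have "\<forall>w\<in>C. k w = h w" using kB C by auto
  then show ?thesis unfolding k_def by blast
qed

text \<open>Real and imaginary parts can be lifted separately since the relation and the exponents
  are real.\<close>

lemma lift_complex:
  fixes h :: "int ^ 'n \<Rightarrow> complex"
  assumes h: "(\<Sum>w\<in>C. of_int (l w) * h w) = 0"
  shows "\<exists>q s. \<forall>w\<in>C. (\<Sum>i\<in>UNIV. of_int (w $ i) * q i) + s = h w"
proof -
  have "(\<Sum>w\<in>C. real_of_int (l w) * Re (h w)) = Re (\<Sum>w\<in>C. of_int (l w) * h w)"
    by simp
  moreover have "(\<Sum>w\<in>C. real_of_int (l w) * Im (h w)) = Im (\<Sum>w\<in>C. of_int (l w) * h w)"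
    by simp
  ultimately obtain q1 s1 q2 s2 where
    1: "\<forall>w\<in>C. (\<Sum>i\<in>UNIV. real_of_int (w $ i) * q1 i) + s1 = Re (h w)" and
    2: "\<forall>w\<in>C. (\<Sum>i\<in>UNIV. real_of_int (w $ i) * q2 i) + s2 = Im (h w)"
    using lift_real[of "\<lambda>w. Re (h w)"] lift_real[of "\<lambda>w. Im (h w)"] h by auto
  show ?thesis
    using 1 2 by (intro exI[of _ "\<lambda>i. Complex (q1 i) (q2 i)"] exI[of _ "Complex s1 s2"])
      (auto simp: complex_eq_iff)
qed

end

section \<open>Monomials and their signs\<close>

text \<open>The simplifier must not turn the field operations of \<^typ>\<open>bit\<close> into bitwise ones, which would hide them from the ring laws.\<close>

declare add_bit_eq_xor [simp del] mult_bit_eq_and [simp del] uminus_bit_def [simp del]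
  minus_bit_def [simp del] divide_bit_def [simp del]

section \<open>Duality over a field and counting over the field with two elements\<close>

definition dot :: "'a::field ^ 'n::finite \<Rightarrow> 'a ^ 'n \<Rightarrow> 'a" where
  "dot x y = (\<Sum>i\<in>UNIV. x $ i * y $ i)"

lemma dot_simps:
  "dot x 0 = 0" "dot x (y + z) = dot x y + dot x z" "dot x (y - z) = dot x y - dot x z"
  "dot x (c *s y) = c * dot x y" "dot (x - y) z = dot x z - dot y z"
  by (simp_all add: dot_def algebra_simps sum.distrib sum_subtractf sum_distrib_left)

lemma dot_sum: "dot x (\<Sum>i\<in>I. f i) = (\<Sum>i\<in>I. dot x (f i))"
  by (induction I rule: infinite_finite_induct) (auto simp: dot_simps)

lemma dot_axis: "dot x (axis i 1) = x $ i"
  by (simp add: dot_def axis_def if_distrib cong: if_cong)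

lemma dot_span_eq_0:
  assumes "y \<in> vec.span B" "\<And>b. b \<in> B \<Longrightarrow> dot x b = 0"
  shows "dot x y = 0"
  using assms(1) by (induction rule: vec.span_induct_alt) (auto simp: dot_simps assms(2))

text \<open>Applying \<open>\<phi> i\<close> to a vanishing combination isolates its coefficient at
  \<open>v i\<close>.\<close>

lemma independent_of_dual_functionals:
  fixes v \<phi> :: "'i \<Rightarrow> 'a::field ^ 'n::finite"
  assumes fin: "finite I" and dual: "\<And>i j. i \<in> I \<Longrightarrow> j \<in> I \<Longrightarrow> dot (\<phi> i) (v j) = (if i = j then 1 else 0)"
  shows "inj_on v I" "vec.independent (v ` I)"
proof -
  show inj: "inj_on v I"
    by (rule inj_onI) (metis dual zero_neq_one)
  have "c (v i) = 0" if i: "i \<in> I" and c: "(\<Sum>x\<in>v ` I. c x *s x) = 0" for c i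
  proof -
    have "0 = dot (\<phi> i) (\<Sum>x\<in>v ` I. c x *s x)" by (simp add: c dot_simps)
    also have "\<dots> = (\<Sum>j\<in>I. c (v j) * dot (\<phi> i) (v j))"
      by (simp add: sum.reindex[OF inj] dot_sum dot_simps)
    also have "\<dots> = (\<Sum>j\<in>I. if i = j then c (v j) else 0)"
      by (rule sum.cong) (use i dual in auto)
    finally show ?thesis using i fin by simp
  qed
  then show "vec.independent (v ` I)" using fin by (auto simp: vec.independent_explicit)
qed

lemma UNIV_bit_eq: "(UNIV :: bit set) = {0, 1}"
  using bit_not_zero_iff by auto

instance bit :: finite
  by standard (simp add: UNIV_bit_eq)

text \<open>Extend a basis of the span of \<open>V\<close> to the whole space: an annihilating
  vector is determined by its pairings with the added basis vectors, each of which takes two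
  values.\<close>

lemma card_annihilator_le:
  fixes V :: "(bit ^ 'n::finite) set"
  shows "card {x. \<forall>v\<in>V. dot x v = 0} \<le> 2 ^ (CARD('n) - vec.dim V)"
proof -
  obtain B where B: "B \<subseteq> V" "vec.independent B" "V \<subseteq> vec.span B" "card B = vec.dim V"
    using vec.basis_exists by blast
  obtain B' where B': "B \<subseteq> B'" "vec.independent B'" "UNIV \<subseteq> vec.span B'"
    using vec.maximal_independent_subset_extend[of B UNIV] B(2) by auto
  have cB': "card B' = CARD('n)"
    using vec.basis_card_eq_dim[of B' UNIV] B' by (simp add: card_cart_basis)
  have fB': "finite B'" using B'(2) vec.independent_explicit by blast
  define F where "F x = restrict (dot x) (B' - B)" for x :: "bit ^ 'n"
  have "inj_on F {x. \<forall>v\<in>V. dot x v = 0}"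
  proof (rule inj_onI)
    fix x y assume x: "x \<in> {x. \<forall>v\<in>V. dot x v = 0}" and y: "y \<in> {x. \<forall>v\<in>V. dot x v = 0}" and eq: "F x = F y"
    have "dot (x - y) b = 0" if "b \<in> B'" for b
    proof (cases "b \<in> B")
      case True
      then show ?thesis using x y B by (auto simp: dot_simps)
    next
      case False
      then show ?thesis using fun_cong[OF eq, of b] that by (simp add: F_def dot_simps)
    qed
    then have "dot (x - y) z = 0" for z using dot_span_eq_0 B'(3) by blast
    from this[of "axis _ 1"] show "x = y" by (simp add: dot_axis vec_eq_iff)
  qed
  moreover have "F ` {x. \<forall>v\<in>V. dot x v = 0} \<subseteq> (B' - B) \<rightarrow>\<^sub>E (UNIV :: bit set)"
    by (intro image_subsetI) (simp add: F_def)
  moreover have "finite ((B' - B) \<rightarrow>\<^sub>E (UNIV :: bit set))"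
    using fB' by (intro finite_PiE) (auto simp: UNIV_bit_eq)
  ultimately have "card {x. \<forall>v\<in>V. dot x v = 0} \<le> card ((B' - B) \<rightarrow>\<^sub>E (UNIV :: bit set))"
    by (rule card_inj_on_le)
  also have "\<dots> = 2 ^ card (B' - B)"
    using fB' by (subst card_PiE) (auto simp: UNIV_bit_eq numeral_2_eq_2)
  also have "card (B' - B) = CARD('n) - vec.dim V"
    using B B' cB' fB' by (simp add: card_Diff_subset finite_subset)
  finally show ?thesis .
qed

section \<open>Laurent monomials and sign vectors\<close>

definition monomial :: "'a::real_normed_field ^ 'n::finite \<Rightarrow> int ^ 'n \<Rightarrow> 'a" where
  "monomial x w = (\<Prod>i\<in>UNIV. (x $ i) powi (w $ i))"

lemma laurent_eval_monomial: "laurent_eval c C x = (\<Sum>w\<in>C. of_real (c w) * monomial x w)"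
  by (simp add: laurent_eval_def monomial_def)

lemma monomial_mult: "monomial (\<chi> i. x $ i * y $ i) w = monomial x w * monomial y w"
  by (simp add: monomial_def power_int_mult_distrib prod.distrib)

lemma monomial_divide: "monomial (\<chi> i. x $ i / y $ i) w = monomial x w / monomial y w"
  by (simp add: monomial_def power_int_divide_distrib prod_dividef)

lemma monomial_nonzero: "(\<And>i. x $ i \<noteq> 0) \<Longrightarrow> monomial x w \<noteq> 0"
  by (simp add: monomial_def)

lemma monomial_exp:
  fixes q :: "'n::finite \<Rightarrow> 'a::{real_normed_field,banach}"
  shows "monomial (\<chi> i. exp (q i)) w = exp (\<Sum>i\<in>UNIV. of_int (w $ i) * q i)"
  by (simp add: monomial_def exp_power_int exp_sum)

lemma monomial_of_real:
  "monomial (\<chi> i. of_real (x $ i)) w = (of_real (monomial x w) :: 'a::real_normed_field)"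
  by (simp add: monomial_def)

definition mod2 :: "int ^ 'n::finite \<Rightarrow> bit ^ 'n" where
  "mod2 w = (\<chi> i. of_int (w $ i))"

text \<open>Signs written additively, as exponents of -1, so that the sign of a monomial becomes
  linear in \<open>mod2 w\<close>.\<close>

definition signs :: "real ^ 'n::finite \<Rightarrow> bit ^ 'n" where
  "signs x = (\<chi> i. if x $ i < 0 then 1 else 0)"

lemma of_int_bit: "(of_int k :: bit) = (if odd k then 1 else 0)"
  by (metis bit_not_zero_iff even_of_int_iff even_zero odd_one)

lemma power_int_less_0_iff: "(x::real) \<noteq> 0 \<Longrightarrow> x powi k < 0 \<longleftrightarrow> x < 0 \<and> odd k"
  by (auto simp: power_int_def zero_less_power_eq power_less_zero_eq even_nat_iff not_less)

text \<open>A power is negative exactly when its base is negative and its exponent odd, and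
  multiplying signs amounts to adding in \<open>bit\<close>.\<close>

lemma monomial_less_0_iff:
  assumes "\<And>i. x $ i \<noteq> 0"
  shows "monomial x w < 0 \<longleftrightarrow> dot (signs x) (mod2 w) = 1"
proof -
  have "(\<Prod>i\<in>I. (x $ i) powi (w $ i)) < 0 \<longleftrightarrow> (\<Sum>i\<in>I. signs x $ i * mod2 w $ i) = 1" if "finite I" for I
    using that
  proof (induction I)
    case (insert i I)
    have nz: "(\<Prod>i\<in>I. (x $ i) powi (w $ i)) \<noteq> 0" "x $ i powi w $ i \<noteq> 0"
      using assms insert by (simp_all add: power_int_eq_0_iff)
    have "(x $ i) powi (w $ i) < 0 \<longleftrightarrow> signs x $ i * mod2 w $ i = 1"
      using power_int_less_0_iff[OF assms, of i "w $ i"] by (simp add: signs_def mod2_def of_int_bit)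
    moreover have "a + b = 1 \<longleftrightarrow> (a = 1 \<longleftrightarrow> b \<noteq> 1)" for a b :: bit
      by (cases a; cases b) auto
    moreover have "a * b < 0 \<longleftrightarrow> (a < 0 \<longleftrightarrow> \<not> b < 0)" if "a \<noteq> 0" "b \<noteq> 0" for a b :: real
      using that by (auto simp: mult_less_0_iff)
    ultimately show ?case using insert nz by simp
  qed simp
  then show ?thesis by (simp add: monomial_def dot_def)
qed

section \<open>Torus points with proportional monomials\<close>

context circuit_relation
begin

text \<open>Differences from one base point are differences of differences from another, so both
  families have the same span. This replaces the arbitrary choice in \<open>rk_mod2\<close> by any
  convenient point.\<close>

lemma rk_mod2_eq:
  assumes w1: "w1 \<in> C"
  shows "rk_mod2 C = vec.dim ((\<lambda>w. mod2 w - mod2 w1) ` C)"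
proof -
  define w' where "w' = (SOME w'. w' \<in> C)"
  have w': "w' \<in> C" using w1 unfolding w'_def by (rule someI)
  have sub: "vec.span ((\<lambda>w. mod2 w - mod2 a) ` C) \<subseteq> vec.span ((\<lambda>w. mod2 w - mod2 b) ` C)" if "a \<in> C" for a b
  proof (rule vec.span_minimal)
    show "(\<lambda>w. mod2 w - mod2 a) ` C \<subseteq> vec.span ((\<lambda>w. mod2 w - mod2 b) ` C)"
    proof clarify
      fix w assume "w \<in> C"
      then have "(mod2 w - mod2 b) - (mod2 a - mod2 b) \<in> vec.span ((\<lambda>w. mod2 w - mod2 b) ` C)"
        using that by (intro vec.span_diff vec.span_base) auto
      then show "mod2 w - mod2 a \<in> vec.span ((\<lambda>w. mod2 w - mod2 b) ` C)" by simp
    qed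
  qed simp
  have "(\<chi> i. of_int (w $ i - a $ i)) = mod2 w - mod2 a" for w a :: "int ^ 'n"
    by (simp add: mod2_def vec_eq_iff)
  then have "rk_mod2 C = vec.dim ((\<lambda>w. mod2 w - mod2 w') ` C)"
    by (simp add: rk_mod2_def Let_def w'_def)
  then show ?thesis using sub[OF w1] sub[OF w']
    by (metis vec.dim_span subset_antisym)
qed

text \<open>In logarithmic coordinates \<open>q\<close>, the functional given by \<open>q\<close> is
  constant on \<open>C\<close>, hence on its affine hull, which is the whole space. So
  \<open>q\<close> is zero.\<close>

lemma abs_eq_1_if_monomials_const:
  assumes nz: "\<And>i. x $ i \<noteq> (0::real)" and const: "\<And>w. w \<in> C \<Longrightarrow> monomial x w = k"
  shows "\<bar>x $ i\<bar> = 1"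
proof -
  define q :: "real ^ 'n" where "q = (\<chi> i. ln \<bar>x $ i\<bar>)"
  have abs: "\<bar>x $ i\<bar> = exp (q $ i)" for i using nz by (simp add: q_def)
  have "exp (q \<bullet> rvec w) = \<bar>monomial x w\<bar>" for w
    by (simp add: monomial_def abs_prod power_int_abs abs exp_power_int inner_vec_def rvec_def mult.commute flip: exp_sum)
  then have "rvec ` C \<subseteq> {v. q \<bullet> v = ln \<bar>k\<bar>}"
    using const by (metis (mono_tags, lifting) image_subsetI ln_exp mem_Collect_eq)
  then have "affine hull (rvec ` C) \<subseteq> {v. q \<bullet> v = ln \<bar>k\<bar>}"
    using affine_hyperplane by (rule hull_minimal)
  then have all: "q \<bullet> v = ln \<bar>k\<bar>" for v using hull_C by blast
  have "q \<bullet> q = 0" using all[of q] all[of 0] by simp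
  then show ?thesis by (simp add: abs)
qed

text \<open>Quotients by a fixed element of \<open>S\<close> have constant monomials on
  \<open>C\<close>, hence coordinates 1 or -1. They are determined by their sign vectors, which
  annihilate the exponent differences modulo 2.\<close>

lemma card_common_ratio_le:
  assumes nz: "\<And>x i. x \<in> S \<Longrightarrow> x $ i \<noteq> (0::real)"
    and ratio: "\<And>x y. x \<in> S \<Longrightarrow> y \<in> S \<Longrightarrow> \<exists>k. \<forall>w\<in>C. monomial x w = k * monomial y w"
  shows "finite S" "card S \<le> 2 ^ (CARD('n) - rk_mod2 C)"
proof -
  define V where "V b = (\<lambda>w. mod2 w - mod2 b) ` C" for b
  obtain w1 where w1: "w1 \<in> C" using D_nonempty D_subset by blast
  let ?K = "{e. \<forall>v\<in>V w1. dot e v = 0}"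
  have fK: "finite ?K"
    by simp
  have "finite S \<and> card S \<le> card ?K"
  proof (cases "S = {}")
    case False
    then obtain y where y: "y \<in> S" by blast
    define Q where "Q x = (\<chi> i. x $ i / y $ i)" for x
    have Qnz: "Q x $ i \<noteq> 0" if "x \<in> S" for x i using nz that y by (simp add: Q_def)
    have Qk: "\<exists>k. \<forall>w\<in>C. monomial (Q x) w = k" if x: "x \<in> S" for x
    proof -
      obtain k where "\<forall>w\<in>C. monomial x w = k * monomial y w" using ratio[OF x y] by blast
      then show ?thesis using monomial_nonzero[of y] nz[OF y]
        by (intro exI[of _ k]) (simp add: Q_def monomial_divide)
    qed
    have "inj_on (\<lambda>x. signs (Q x)) S"
    proof (rule inj_onI)
      fix x z assume x: "x \<in> S" and z: "z \<in> S" and eq: "signs (Q x) = signs (Q z)"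
      have "Q x $ i = Q z $ i" for i
      proof -
        have "\<bar>Q x $ i\<bar> = 1" using abs_eq_1_if_monomials_const Qk[OF x] Qnz[OF x] by metis
        moreover have "\<bar>Q z $ i\<bar> = 1" using abs_eq_1_if_monomials_const Qk[OF z] Qnz[OF z] by metis
        moreover have "Q x $ i < 0 \<longleftrightarrow> Q z $ i < 0"
          using eq by (simp add: signs_def vec_eq_iff) (metis zero_neq_one)
        ultimately show ?thesis by linarith
      qed
      then show "x = z" using nz[OF y] by (simp add: Q_def vec_eq_iff)
    qed
    moreover have "(\<lambda>x. signs (Q x)) ` S \<subseteq> ?K"
    proof clarify
      fix x v assume x: "x \<in> S" and "v \<in> V w1"
      then obtain w where w: "w \<in> C" "v = mod2 w - mod2 w1" by (auto simp: V_def)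
      have "monomial (Q x) w = monomial (Q x) w1" using Qk[OF x] w w1 by auto
      then have "dot (signs (Q x)) (mod2 w) = 1 \<longleftrightarrow> dot (signs (Q x)) (mod2 w1) = 1"
        using monomial_less_0_iff[OF Qnz[OF x]] by metis
      then show "dot (signs (Q x)) v = 0"
        unfolding w dot_simps
        by (cases "dot (signs (Q x)) (mod2 w)"; cases "dot (signs (Q x)) (mod2 w1)") auto
    qed
    ultimately show ?thesis using fK by (meson card_inj_on_le inj_on_finite)
  qed simp
  moreover have "card ?K \<le> 2 ^ (CARD('n) - rk_mod2 C)"
    using card_annihilator_le[of "V w1"] by (simp add: rk_mod2_eq[OF w1] V_def)
  ultimately show "finite S" "card S \<le> 2 ^ (CARD('n) - rk_mod2 C)" by auto
qed

end

section \<open>Rank-deficient systems\<close>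

context circuit_relation
begin

text \<open>A zero of a holomorphic function of two variables is never isolated: by Hurwitz's
  theorem a zero in \<open>s\<close> at \<open>t = 0\<close> persists for small \<open>t\<close>.\<close>

lemma infinite_log_relation_zeros:
  fixes u v :: "int ^ 'n \<Rightarrow> real"
  shows "infinite {(s, t). (\<forall>w\<in>C. 1 + s * of_real (u w) + t * of_real (v w) \<noteq> (0::complex)) \<and>
    (\<Sum>w\<in>C. of_int (l w) * Ln (1 + s * of_real (u w) + t * of_real (v w))) = 0}" (is "infinite ?P")
proof
  assume fin: "finite ?P"
  \<comment> \<open>For \<open>s\<close> and \<open>t\<close> of norm at most \<open>r\<close> each
    linear form differs from 1 by at most 1/2, so it has positive real part and the principal
    logarithm is holomorphic.\<close>
  define M where "M = 1 + (\<Sum>w\<in>C. \<bar>u w\<bar> + \<bar>v w\<bar>)"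
  define r where "r = 1 / (2 * M)"
  have M: "M \<ge> 1" by (simp add: M_def sum_nonneg)
  have r: "r > 0" using M by (simp add: r_def)
  have Re_pos: "Re (1 + s * of_real (u w) + t * of_real (v w)) > 0"
    if "w \<in> C" "norm s \<le> r" "norm t \<le> r" for s t :: complex and w
  proof -
    have "\<bar>u w\<bar> + \<bar>v w\<bar> < M"
      using member_le_sum[of w C "\<lambda>w. \<bar>u w\<bar> + \<bar>v w\<bar>"] that finite_C by (simp add: M_def)
    have "norm (s * of_real (u w) + t * of_real (v w)) \<le> norm s * \<bar>u w\<bar> + norm t * \<bar>v w\<bar>"
      by (metis norm_mult norm_of_real norm_triangle_ineq)
    also have "\<dots> \<le> r * \<bar>u w\<bar> + r * \<bar>v w\<bar>"
      using that by (intro add_mono mult_right_mono) auto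
    also have "\<dots> \<le> r * M" using \<open>\<bar>u w\<bar> + \<bar>v w\<bar> < M\<close> r by (simp flip: distrib_left)
    also have "\<dots> = 1 / 2" using M by (simp add: r_def)
    finally have "\<bar>Re (s * of_real (u w) + t * of_real (v w))\<bar> \<le> 1 / 2"
      using abs_Re_le_cmod order_trans by blast
    then have "- (1 / 2) \<le> Re (s * of_real (u w) + t * of_real (v w))" by linarith
    then show ?thesis unfolding add.assoc plus_complex.sel(1)[of 1] by simp
  qed
  define H where "H s t = (\<Sum>w\<in>C. of_int (l w) * Ln (1 + s * of_real (u w) + t * of_real (v w)))"
    for s t :: complex
  have P: "(s, t) \<in> ?P" if "norm s \<le> r" "norm t \<le> r" "H s t = 0" for s t
  proof -
    have "1 + s * of_real (u w) + t * of_real (v w) \<noteq> 0" if "w \<in> C" for w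
      using Re_pos[OF that \<open>norm s \<le> r\<close> \<open>norm t \<le> r\<close>] by (metis less_irrefl zero_complex.sel(1))
    then show ?thesis using \<open>H s t = 0\<close> by (simp add: H_def)
  qed
  have nonpos: "1 + s * of_real (u w) + t * of_real (v w) \<notin> \<real>\<^sub>\<le>\<^sub>0"
    if "w \<in> C" "norm s \<le> r" "norm t \<le> r" for s t :: complex and w
    using Re_pos[OF that] by (auto simp: complex_nonpos_Reals_iff)
  have hol: "(\<lambda>s. H s t) holomorphic_on ball 0 r" if "norm t \<le> r" for t
    unfolding H_def using nonpos that by (intro holomorphic_intros) auto
  have cont: "continuous_on (cball 0 r \<times> cball 0 r) (\<lambda>z. H (fst z) (snd z))"
    unfolding H_def using nonpos by (intro continuous_intros) auto
  have H0: "H 0 0 = 0" by (simp add: H_def)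
  show False
  proof (cases "(\<lambda>s. H s 0) constant_on ball 0 r")
    \<comment> \<open>The constant is \<open>H 0 0\<close>, which is zero, so a whole disc in the
      \<open>s\<close> direction consists of zeros.\<close>
    case True
    then have "H s 0 = 0" if "s \<in> ball 0 r" for s
      using H0 r that unfolding constant_on_def by (metis centre_in_ball)
    then have "(\<lambda>s. (s, 0)) ` ball 0 r \<subseteq> ?P"
      using r by (intro image_subsetI P) auto
    then have "finite ((\<lambda>s. (s, 0::complex)) ` ball (0::complex) r)" using fin finite_subset by blast
    then have "finite (ball (0::complex) r)" by (rule finite_imageD) (auto simp: inj_on_def)
    then show False using r uncountable_ball countable_finite by blast
  next
    case False
    define \<tau> where "\<tau> k = complex_of_real (r / (real k + 1))" for k :: nat
    have tau: "norm (\<tau> k) \<le> r" for k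
    proof -
      have "r / (real k + 1) \<le> r / 1" using r by (intro divide_left_mono) auto
      then show ?thesis unfolding \<tau>_def norm_of_real using r by simp
    qed
    have tau_lim: "\<tau> \<longlonglongrightarrow> 0"
    proof -
      have "(\<lambda>k. r / (real k + 1)) \<longlonglongrightarrow> 0" by real_asymp
      then show ?thesis unfolding \<tau>_def using tendsto_of_real[where ?'a = complex] by fastforce
    qed
    have inj_tau: "inj \<tau>" 
      using r unfolding inj_on_def \<tau>_def of_real_eq_iff by (simp add: frac_eq_eq)
    have "finite (\<tau> -` (snd ` ?P))" using fin inj_tau by (intro finite_vimageI) auto
    then have "\<exists>N. \<forall>k\<in>\<tau> -` (snd ` ?P). k < N" by (simp only: finite_nat_set_iff_bounded)
    then obtain N where "\<forall>k\<in>\<tau> -` (snd ` ?P). k < N" by blast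
    then have N: "k < N" if "\<tau> k \<in> snd ` ?P" for k using that by blast
    \<comment> \<open>The \<open>\<tau> k\<close> are distinct and the zeros were assumed finite in
      number, so after dropping \<open>N\<close> terms no \<open>F k\<close> has a zero in the ball.
      Hurwitz then contradicts the zero of the limit at the origin.\<close>
    define F where "F k = (\<lambda>s. H s (\<tau> (k + N)))" for k
    have lim: "(\<lambda>k. \<tau> (k + N)) \<longlonglongrightarrow> 0" using tau_lim by (rule LIMSEQ_ignore_initial_segment)
    have unif: "uniformly_continuous_on (cball 0 r \<times> cball 0 r) (\<lambda>z. H (fst z) (snd z))"
      using cont by (intro compact_uniformly_continuous compact_Times) auto
    have "H 0 0 \<noteq> 0"
    proof (rule Hurwitz_no_zeros[of "ball 0 r" F "\<lambda>s. H s 0"])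
      show "uniform_limit K F (\<lambda>s. H s 0) sequentially" if K: "compact K" "K \<subseteq> ball 0 r" for K
      proof (rule uniform_limitI)
        fix e :: real assume "e > 0"
        then obtain d where d: "d > 0" and
          close: "\<And>z z'. z \<in> cball 0 r \<times> cball 0 r \<Longrightarrow> z' \<in> cball 0 r \<times> cball 0 r \<Longrightarrow> dist z' z < d \<Longrightarrow>
            dist (H (fst z') (snd z')) (H (fst z) (snd z)) < e"
          using unif unfolding uniformly_continuous_on_def by metis
        have "\<forall>\<^sub>F k in sequentially. dist (\<tau> (k + N)) 0 < d"
          using lim d by (rule tendstoD)
        then show "\<forall>\<^sub>F k in sequentially. \<forall>s\<in>K. dist (F k s) (H s 0) < e"
        proof eventually_elim
          case (elim k)
          show ?case
          proof
            fix s assume "s \<in> K"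
            then have "s \<in> cball 0 r" using K by auto
            moreover have "dist (s, \<tau> (k + N)) (s, 0) < d" using elim by (simp add: dist_Pair_Pair)
            ultimately show "dist (F k s) (H s 0) < e"
              using close[of "(s, 0)" "(s, \<tau> (k + N))"] tau r by (simp add: F_def)
          qed
        qed
      qed
      show "F k s \<noteq> 0" if "s \<in> ball 0 r" for k s
      proof
        assume "F k s = 0"
        then have "(s, \<tau> (k + N)) \<in> ?P" using that tau by (intro P) (auto simp: F_def)
        then have "\<tau> (k + N) \<in> snd ` ?P" by (simp only: image_eqI[where x = "(s, \<tau> (k + N))"] snd_conv)
        from N[OF this] show False by simp
      qed
    qed (use False r hol tau in \<open>auto simp: F_def\<close>)
    then show False using H0 by simp
  qed
qed

text \<open>Scaling the monomials of \<open>x0\<close> by \<open>1 + s * u w + t * v w\<close>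
  preserves the equations, and on the zeros of the logarithmic relation \<open>lift_complex\<close>
  realises the scaling by a torus point. Independence of 1, \<open>u\<close> and \<open>v\<close>
  makes these points distinct.\<close>

lemma infinite_complex_solutions:
  fixes c :: "'n \<Rightarrow> int ^ 'n \<Rightarrow> real" and x0 :: "real ^ 'n"
  assumes x0: "x0 \<in> torus_solutions c C"
    and u: "\<And>j. (\<Sum>w\<in>C. c j w * monomial x0 w * u w) = 0"
    and v: "\<And>j. (\<Sum>w\<in>C. c j w * monomial x0 w * v w) = 0"
    and indep: "\<And>\<alpha> \<beta> \<gamma>. \<forall>w\<in>C. \<alpha> + \<beta> * u w + \<gamma> * v w = 0 \<Longrightarrow> \<alpha> = 0 \<and> \<beta> = 0 \<and> \<gamma> = 0"
  shows "infinite (torus_solutions c C :: (complex ^ 'n) set)"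
proof
  assume fin: "finite (torus_solutions c C :: (complex ^ 'n) set)"
  define g :: "complex \<times> complex \<Rightarrow> int ^ 'n \<Rightarrow> complex"
    where "g z w = 1 + fst z * of_real (u w) + snd z * of_real (v w)" for z w
  define P where "P = {z. (\<forall>w\<in>C. g z w \<noteq> 0) \<and> (\<Sum>w\<in>C. of_int (l w) * Ln (g z w)) = 0}"
  have infP: "infinite P"
    using infinite_log_relation_zeros[of u v] by (simp add: P_def g_def case_prod_unfold)
  have "\<forall>z. \<exists>q s. z \<in> P \<longrightarrow> (\<forall>w\<in>C. (\<Sum>i\<in>UNIV. of_int (w $ i) * q i) + s = Ln (g z w))"
    using lift_complex by (fastforce simp: P_def)
  then obtain q s where qs: "\<And>z w. z \<in> P \<Longrightarrow> w \<in> C \<Longrightarrow> (\<Sum>i\<in>UNIV. of_int (w $ i) * q z i) + s z = Ln (g z w)"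
    by metis
  define X :: "complex \<times> complex \<Rightarrow> complex ^ 'n"
    where "X z = (\<chi> i. (\<chi> i. of_real (x0 $ i)) $ i * (\<chi> i. exp (q z i)) $ i)" for z
  have x0nz: "\<And>i. x0 $ i \<noteq> 0" and x0sol: "\<And>j. (\<Sum>w\<in>C. c j w * monomial x0 w) = 0"
    using x0 by (auto simp: torus_solutions_def laurent_eval_monomial)
  have mX: "monomial (X z) w = of_real (monomial x0 w) * g z w * exp (- s z)" if "z \<in> P" "w \<in> C" for z w
  proof -
    have "(\<Sum>i\<in>UNIV. of_int (w $ i) * q z i) = Ln (g z w) - s z"
      using qs[OF that] by (simp add: algebra_simps)
    moreover have "g z w \<noteq> 0" using that by (simp add: P_def)
    moreover from this have "exp (Ln (g z w)) = g z w" by (rule exp_Ln)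
    ultimately show ?thesis
      unfolding X_def monomial_mult monomial_of_real monomial_exp
      by (simp only: exp_diff exp_minus divide_inverse mult.assoc)
  qed
  have "X ` P \<subseteq> torus_solutions c C"
  proof clarify
    fix a b assume z: "(a, b) \<in> P"
    have "laurent_eval (c j) C (X (a, b)) = 0" for j
    proof -
      have "laurent_eval (c j) C (X (a, b)) = (\<Sum>w\<in>C. of_real (c j w) * (of_real (monomial x0 w) * g (a, b) w * exp (- s (a, b))))"
        unfolding laurent_eval_monomial using mX[OF z] by simp
      also have "\<dots> = exp (- s (a, b)) * (of_real (\<Sum>w\<in>C. c j w * monomial x0 w) + a * of_real (\<Sum>w\<in>C. c j w * monomial x0 w * u w) + b * of_real (\<Sum>w\<in>C. c j w * monomial x0 w * v w))"
        by (simp add: g_def sum_distrib_left sum.distrib algebra_simps)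
      finally show ?thesis using x0sol u v by simp
    qed
    then show "X (a, b) \<in> torus_solutions c C" using x0nz by (simp add: torus_solutions_def X_def)
  qed
  moreover have "inj_on X P"
  proof (rule inj_onI)
    fix z z' assume z: "z \<in> P" and z': "z' \<in> P" and eq: "X z = X z'"
    let ?e = "exp (- s z)" and ?e' = "exp (- s z')"
    \<comment> \<open>Coefficients of a combination of 1, \<open>u\<close> and \<open>v\<close> that
      vanishes on \<open>C\<close>. Being complex, they are fed to the real independence hypothesis
      through real and imaginary parts.\<close>
    let ?\<alpha> = "?e - ?e'" and ?\<beta> = "fst z * ?e - fst z' * ?e'" and ?\<gamma> = "snd z * ?e - snd z' * ?e'"
    have "?\<alpha> + ?\<beta> * of_real (u w) + ?\<gamma> * of_real (v w) = 0" if w: "w \<in> C" for w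
    proof -
      have "g z w * ?e = g z' w * ?e'"
        using mX[OF z w] mX[OF z' w] eq monomial_nonzero[of x0 w] x0nz by simp
      then show ?thesis by (simp add: g_def algebra_simps)
    qed
    then have "\<forall>w\<in>C. Re ?\<alpha> + Re ?\<beta> * u w + Re ?\<gamma> * v w = 0" "\<forall>w\<in>C. Im ?\<alpha> + Im ?\<beta> * u w + Im ?\<gamma> * v w = 0"
      by (auto simp only: complex_eq_iff plus_complex.sel Re_complex_of_real Im_complex_of_real times_complex.sel zero_complex.sel
          mult_zero_right add_0_right add_0_left diff_zero)
    from indep[OF this(1)] indep[OF this(2)] have "?\<alpha> = 0" "?\<beta> = 0" "?\<gamma> = 0"
      by (auto simp only: complex_eq_iff zero_complex.sel)
    then show "z = z'" by (simp add: prod_eq_iff)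
  qed
  ultimately show False using fin infP by (metis finite_subset finite_imageD)
qed

end

section \<open>Solutions along a pencil\<close>

text \<open>Scan \<open>Y\<close> from left to right: a new point either opens a new class or, by
  convexity, shares the class of its predecessor and so has a separator just before it.\<close>

lemma card_le_card_separators_plus_classes:
  fixes Y Z :: "'a::linorder set"
  assumes fin: "finite Y" "finite Z"
    and sep: "\<And>y y'. y \<in> Y \<Longrightarrow> y' \<in> Y \<Longrightarrow> y < y' \<Longrightarrow> \<kappa> y = \<kappa> y' \<Longrightarrow> \<exists>z\<in>Z. y < z \<and> z < y'"
    and convex: "\<And>x y z. x \<in> Y \<Longrightarrow> y \<in> Y \<Longrightarrow> z \<in> Y \<Longrightarrow> x \<le> y \<Longrightarrow> y \<le> z \<Longrightarrow> \<kappa> x = \<kappa> z \<Longrightarrow> \<kappa> y = \<kappa> z"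
  shows "card Y \<le> card Z + card (\<kappa> ` Y)"
proof -
  \<comment> \<open>Only separators below some point of \<open>A\<close> are counted, so that the
    one found in the induction step is new.\<close>
  have "A \<subseteq> Y \<longrightarrow> card A \<le> card {z \<in> Z. \<exists>y\<in>A. z < y} + card (\<kappa> ` A)" if "finite A" for A
    using that
  proof (induction A rule: finite_linorder_max_induct)
    case (insert b A)
    show ?case
    proof
      assume sub: "insert b A \<subseteq> Y"
      have IH: "card A \<le> card {z \<in> Z. \<exists>y\<in>A. z < y} + card (\<kappa> ` A)" using insert sub by blast
      have b: "b \<notin> A" using insert by blast
      have mono: "{z \<in> Z. \<exists>y\<in>A. z < y} \<subseteq> {z \<in> Z. \<exists>y\<in>insert b A. z < y}" by blast
      have finZ: "finite {z \<in> Z. \<exists>y\<in>insert b A. z < y}" using fin by simp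
      show "card (insert b A) \<le> card {z \<in> Z. \<exists>y\<in>insert b A. z < y} + card (\<kappa> ` insert b A)"
      proof (cases "\<kappa> b \<in> \<kappa> ` A")
        case False
        then have "card (\<kappa> ` insert b A) = Suc (card (\<kappa> ` A))" using insert by simp
        then show ?thesis using IH card_mono[OF finZ mono] b insert by simp
      next
        case True
        then obtain y where y: "y \<in> A" "\<kappa> b = \<kappa> y" by blast
        define m where "m = Max A"
        have m: "m \<in> A" "\<And>x. x \<in> A \<Longrightarrow> x \<le> m" 
          using Max_in[of A] Max_ge[of A] y(1) insert(1) unfolding m_def by blast+
        have mb: "m < b" using insert m by blast
        have "y \<in> Y" "m \<in> Y" "b \<in> Y" using y m sub by auto
        then have "\<kappa> m = \<kappa> b" using convex[of y m b] y(2) m(2)[OF y(1)] mb by simp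
        then obtain z where z: "z \<in> Z" "m < z" "z < b" using sep[of m b] m mb sub by auto
        have "z \<notin> {z \<in> Z. \<exists>y\<in>A. z < y}" using z m(2) by force
        then have "{z \<in> Z. \<exists>y\<in>A. z < y} \<subset> {z \<in> Z. \<exists>y\<in>insert b A. z < y}"
          using z by blast
        then have "card {z \<in> Z. \<exists>y\<in>A. z < y} < card {z \<in> Z. \<exists>y\<in>insert b A. z < y}"
          by (rule psubset_card_mono[OF finZ])
        moreover have "\<kappa> ` insert b A = \<kappa> ` A" using True by blast
        ultimately show ?thesis using IH b insert by simp
      qed
    qed
  qed simp
  then have "card Y \<le> card {z \<in> Z. \<exists>y\<in>Y. z < y} + card (\<kappa> ` Y)" using fin by blast
  moreover have "card {z \<in> Z. \<exists>y\<in>Y. z < y} \<le> card Z" using fin by (intro card_mono) auto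
  ultimately show ?thesis by linarith
qed

section \<open>Signs and logarithms of real linear forms\<close>

lemma same_sign_linear:
  fixes a y y' :: real
  assumes "a \<noteq> 0" "y < - 1 / a \<longleftrightarrow> y' < - 1 / a" "1 + y * a \<noteq> 0" "1 + y' * a \<noteq> 0"
  shows "1 + y * a < 0 \<longleftrightarrow> 1 + y' * a < 0"
proof -
  have e: "1 + x * a = a * (x - (- 1 / a))" for x using assms(1) by (simp add: field_simps)
  show ?thesis using assms unfolding e by (auto simp: mult_less_0_iff)
qed

lemma opposite_sign_linear:
  fixes a y y' :: real
  assumes "a \<noteq> 0" "y < - 1 / a" "- 1 / a < y'"
  shows "1 + y * a < 0 \<longleftrightarrow> \<not> 1 + y' * a < 0"
proof -
  have e: "1 + x * a = a * (x - (- 1 / a))" for x using assms(1) by (simp add: field_simps)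
  show ?thesis using assms unfolding e by (auto simp: mult_less_0_iff)
qed

lemma has_real_derivative_ln_abs:
  assumes "x \<noteq> (0::real)"
  shows "((\<lambda>x. ln \<bar>x\<bar>) has_real_derivative 1 / x) (at x)"
proof (cases "x > 0")
  case True
  have "(ln has_real_derivative 1 / x) (at x)" using True by (auto intro!: derivative_eq_intros)
  then show ?thesis
    by (rule has_field_derivative_transform_within_open[OF _ open_greaterThan[of 0]]) (use True in auto)
next
  case False
  then have neg: "x < 0" using assms by simp
  have "((\<lambda>x. ln (- x)) has_real_derivative 1 / x) (at x)"
    using neg by (auto intro!: derivative_eq_intros simp: field_simps)
  then show ?thesis
    by (rule has_field_derivative_transform_within_open[OF _ open_lessThan[of 0]]) (use neg in auto)
qed

text \<open>The monomial vectors of the solutions, divided by those of a fixed solution, lie in the plane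
  spanned by \<open>1\<close> and \<open>a\<close>. Normalising \<open>a w1 = 0\<close> for some \<open>w1\<close> in the support of the relation
  puts a point that no solution reaches at infinity, so that a real parameter \<open>y\<close> suffices.\<close>

locale circuit_pencil = circuit_relation C l
  for C :: "(int ^ 'n::finite) set" and l :: "int ^ 'n \<Rightarrow> int" +
  fixes a :: "int ^ 'n \<Rightarrow> real" and w1 :: "int ^ 'n"
  assumes w1: "w1 \<in> D" and a_w1: "a w1 = 0"
begin

text \<open>In the application these are quotients of solutions by a fixed solution;
  \<open>k\<close> is the common factor of their monomials.\<close>

definition fibre :: "real \<Rightarrow> (real ^ 'n) set" where
  "fibre y = {x. (\<forall>i. x $ i \<noteq> 0) \<and> (\<exists>k. \<forall>w\<in>C. monomial x w = k * (1 + y * a w))}"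

definition Y :: "real set" where "Y = {y. fibre y \<noteq> {}}"

text \<open>The logarithm of the absolute value of the product of the linear forms raised to the
  powers \<open>l w\<close>, the function known from Gale duality.\<close>

definition G :: "real \<Rightarrow> real" where
  "G y = (\<Sum>w\<in>D. real_of_int (l w) * ln \<bar>1 + y * a w\<bar>)"

definition R :: "real set" where "R = (\<lambda>w. - 1 / a w) ` {w \<in> D. a w \<noteq> 0}"

lemma w1_C: "w1 \<in> C" using w1 D_subset by blast

lemma sum_D: "(\<Sum>w\<in>D. real_of_int (l w) * h w) = (\<Sum>w\<in>C. real_of_int (l w) * h w)"
  by (rule sum.mono_neutral_left) (auto simp: D_def finite_C)

lemma fibre_card_le: "finite (fibre y)" "card (fibre y) \<le> 2 ^ (CARD('n) - rk_mod2 C)"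
proof -
  have "\<exists>k. \<forall>w\<in>C. monomial x w = k * monomial x' w" if x: "x \<in> fibre y" and x': "x' \<in> fibre y" for x x'
  proof -
    obtain k k' where k: "\<forall>w\<in>C. monomial x w = k * (1 + y * a w)" "\<forall>w\<in>C. monomial x' w = k' * (1 + y * a w)"
      using x x' unfolding fibre_def by blast
    have "k' \<noteq> 0" using k(2) w1_C x' monomial_nonzero[of x' w1] by (auto simp: fibre_def)
    then show ?thesis using k by (intro exI[of _ "k / k'"]) simp
  qed
  then show "finite (fibre y)" "card (fibre y) \<le> 2 ^ (CARD('n) - rk_mod2 C)"
    by (auto intro!: card_common_ratio_le simp: fibre_def)
qed

text \<open>The normalisation of \<open>a\<close> at \<open>w1\<close> identifies the common factor
  with the monomial at \<open>w1\<close>.\<close>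

lemma fibre_monomial:
  assumes "x \<in> fibre y" "w \<in> C"
  shows "monomial x w = monomial x w1 * (1 + y * a w)"
proof -
  obtain k where k: "\<forall>w\<in>C. monomial x w = k * (1 + y * a w)" using assms by (auto simp: fibre_def)
  then show ?thesis using assms w1_C a_w1 by simp
qed

lemma fibre_nonzero:
  assumes "x \<in> fibre y" "w \<in> C"
  shows "1 + y * a w \<noteq> 0"
  using fibre_monomial[OF assms] monomial_nonzero[of x w] assms by (auto simp: fibre_def)

lemma Y_nonzero: "y \<in> Y \<Longrightarrow> w \<in> C \<Longrightarrow> 1 + y * a w \<noteq> 0"
  using fibre_nonzero by (auto simp: Y_def)

text \<open>Up to a constant, the logarithms of the forms are those of the monomials of a point in
  the fibre, hence affine in \<open>w\<close> and killed by the relation.\<close>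

lemma G_eq_0:
  assumes "y \<in> Y"
  shows "G y = 0"
proof -
  obtain x where x: "x \<in> fibre y" using assms by (auto simp: Y_def)
  have nz: "x $ i \<noteq> 0" for i using x by (simp add: fibre_def)
  have ln_mon: "ln \<bar>monomial x w\<bar> = (\<Sum>i\<in>UNIV. real_of_int (w $ i) * ln \<bar>x $ i\<bar>)" for w
  proof -
    have "\<bar>monomial x w\<bar> = monomial (\<chi> i. exp (ln \<bar>x $ i\<bar>)) w"
      using nz by (simp add: monomial_def abs_prod power_int_abs)
    then show ?thesis by (simp add: monomial_exp)
  qed
  have "ln \<bar>1 + y * a w\<bar> = (\<Sum>i\<in>UNIV. real_of_int (w $ i) * ln \<bar>x $ i\<bar>) + (- ln \<bar>monomial x w1\<bar>)" if "w \<in> C" for w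
    using fibre_monomial[OF x that] fibre_nonzero[OF x that] monomial_nonzero[of x w1] nz
    by (simp add: abs_mult ln_mult flip: ln_mon)
  then have "G y = (\<Sum>w\<in>C. real_of_int (l w) * ((\<Sum>i\<in>UNIV. real_of_int (w $ i) * ln \<bar>x $ i\<bar>) + (- ln \<bar>monomial x w1\<bar>)))"
    unfolding G_def sum_D by (intro sum.cong) auto
  then show ?thesis by (simp only: relation_eq_0)
qed

text \<open>Converse of \<open>G_eq_0\<close> while no form changes sign: the logarithms of the
  positive ratios satisfy the relation, so they lift to a positive torus point that moves
  \<open>x0\<close> into the fibre over \<open>y\<close>.\<close>

lemma Y_continuation:
  assumes y0: "y0 \<in> Y" and pos: "\<And>w. w \<in> C \<Longrightarrow> (1 + y * a w) / (1 + y0 * a w) > 0" and G: "G y = 0"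
  shows "y \<in> Y"
proof -
  obtain x0 where x0: "x0 \<in> fibre y0" using y0 by (auto simp: Y_def)
  have x0nz: "x0 $ i \<noteq> 0" for i using x0 by (simp add: fibre_def)
  define h where "h w = ln ((1 + y * a w) / (1 + y0 * a w))" for w
  have h: "h w = ln \<bar>1 + y * a w\<bar> - ln \<bar>1 + y0 * a w\<bar>" if "w \<in> C" for w
  proof -
    have nz: "1 + y0 * a w \<noteq> 0" "1 + y * a w \<noteq> 0" using pos[OF that] by auto
    have "(1 + y * a w) / (1 + y0 * a w) = \<bar>1 + y * a w\<bar> / \<bar>1 + y0 * a w\<bar>"
      using pos[OF that] by (simp flip: abs_divide)
    then show ?thesis unfolding h_def using nz by (simp add: ln_div)
  qed
  have "(\<Sum>w\<in>C. real_of_int (l w) * h w) = G y - G y0"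
    unfolding G_def sum_D using h by (simp add: right_diff_distrib sum_subtractf)
  then have "(\<Sum>w\<in>C. real_of_int (l w) * h w) = 0" using G G_eq_0[OF y0] by simp
  then obtain q s where qs: "\<forall>w\<in>C. (\<Sum>i\<in>UNIV. real_of_int (w $ i) * q i) + s = h w"
    using lift_real by blast
  define x where "x = (\<chi> i. x0 $ i * (\<chi> i. exp (q i)) $ i)"
  have "monomial x w = (monomial x0 w1 * exp (- s)) * (1 + y * a w)" if w: "w \<in> C" for w
  proof -
    have "monomial x w = monomial x0 w * exp (h w - s)"
      unfolding x_def monomial_mult monomial_exp using qs w by (metis add_diff_cancel_right')
    also have "exp (h w - s) = (1 + y * a w) / (1 + y0 * a w) * exp (- s)"
      using pos[OF w] by (simp add: exp_diff exp_minus h_def field_simps)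
    finally show ?thesis using fibre_monomial[OF x0 w] fibre_nonzero[OF x0 w] by simp
  qed
  then have "x \<in> fibre y" using x0nz unfolding fibre_def by (auto simp: x_def)
  then show ?thesis by (auto simp: Y_def)
qed

lemma disjoint_fibre:
  assumes "w \<in> C" "a w \<noteq> 0" "x \<in> fibre y" "x \<in> fibre y'"
  shows "y = y'"
proof -
  have "monomial x w1 * (1 + y * a w) = monomial x w1 * (1 + y' * a w)"
    by (rule trans[OF fibre_monomial[OF assms(3,1), symmetric] fibre_monomial[OF assms(4,1)]])
  moreover have "monomial x w1 \<noteq> 0" using assms by (intro monomial_nonzero) (auto simp: fibre_def)
  ultimately show ?thesis using assms(2) by auto
qed

lemma finite_Y:
  assumes "finite (\<Union>y. fibre y)" "w \<in> C" "a w \<noteq> 0"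
  shows "finite Y"
proof -
  define f where "f y = (SOME x. x \<in> fibre y)" for y
  have f: "f y \<in> fibre y" if "y \<in> Y" for y using that unfolding f_def Y_def by (simp add: some_in_eq)
  have "inj_on f Y" using f disjoint_fibre[OF assms(2,3)] by (metis inj_onI)
  moreover have "f ` Y \<subseteq> (\<Union>y. fibre y)" using f by blast
  ultimately show ?thesis using assms(1) by (metis finite_subset finite_imageD)
qed

section \<open>Zeros of the logarithmic derivative\<close>

lemma finite_R: "finite R" using finite_D by (simp add: R_def)

lemma nonzero_iff_notin_R: "(\<forall>w\<in>D. 1 + y * a w \<noteq> 0) \<longleftrightarrow> y \<notin> R"
proof
  assume *: "\<forall>w\<in>D. 1 + y * a w \<noteq> 0"
  show "y \<notin> R"
  proof
    assume "y \<in> R"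
    then obtain w where "w \<in> D" "a w \<noteq> 0" "y = - 1 / a w" by (auto simp: R_def)
    then show False using * by auto
  qed
next
  assume *: "y \<notin> R"
  show "\<forall>w\<in>D. 1 + y * a w \<noteq> 0"
  proof (intro ballI notI)
    fix w assume w: "w \<in> D" "1 + y * a w = 0"
    then have "a w \<noteq> 0" by auto
    moreover have "y = - 1 / a w" using w calculation by (simp add: field_simps add_eq_0_iff)
    ultimately show False using * w by (auto simp: R_def)
  qed
qed

lemma Y_notin_R: "y \<in> Y \<Longrightarrow> y \<notin> R"
  using Y_nonzero D_subset nonzero_iff_notin_R by blast

text \<open>The residue of \<open>G'\<close> at \<open>\<rho>\<close>; several forms may share a
  root.\<close>

definition \<mu> :: "real \<Rightarrow> real" where
  "\<mu> \<rho> = (\<Sum>w\<in>{w \<in> D. a w \<noteq> 0 \<and> - 1 / a w = \<rho>}. real_of_int (l w))"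

text \<open>The numerator of the logarithmic derivative \<open>G'\<close> over the common denominator
  \<open>\<Prod>\<rho>\<in>R. z - \<rho>\<close>.\<close>

definition P :: "real poly" where
  "P = (\<Sum>\<rho>\<in>R. smult (\<mu> \<rho>) (\<Prod>\<sigma>\<in>R - {\<rho>}. [:- \<sigma>, 1:]))"

lemma G_derivative:
  assumes z: "z \<notin> R"
  shows "(G has_real_derivative poly P z / (\<Prod>\<rho>\<in>R. z - \<rho>)) (at z)"
proof -
  have nz: "1 + z * a w \<noteq> 0" if "w \<in> D" for w using z that nonzero_iff_notin_R by blast
  have "((\<lambda>y. ln \<bar>1 + y * a w\<bar>) has_real_derivative a w / (1 + z * a w)) (at z)" if "w \<in> D" for w
  proof -
    have "((\<lambda>x. ln \<bar>x\<bar>) has_real_derivative 1 / (1 + z * a w)) (at (1 + z * a w))"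
      using has_real_derivative_ln_abs nz[OF that] by blast
    then have "((\<lambda>y. ln \<bar>1 + y * a w\<bar>) has_real_derivative 1 / (1 + z * a w) * a w) (at z)"
      by (rule DERIV_chain2) (auto intro!: derivative_eq_intros)
    then show ?thesis by simp
  qed
  then have "(G has_real_derivative (\<Sum>w\<in>D. real_of_int (l w) * (a w / (1 + z * a w)))) (at z)"
    unfolding G_def by (intro DERIV_sum DERIV_cmult)
  also have "(\<Sum>w\<in>D. real_of_int (l w) * (a w / (1 + z * a w))) = poly P z / (\<Prod>\<rho>\<in>R. z - \<rho>)"
  proof -
    let ?D = "{w \<in> D. a w \<noteq> 0}"
    have "(\<Sum>w\<in>D. real_of_int (l w) * (a w / (1 + z * a w))) = (\<Sum>w\<in>?D. real_of_int (l w) * (a w / (1 + z * a w)))"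
      using finite_D by (intro sum.mono_neutral_right) auto
    also have "\<dots> = (\<Sum>w\<in>?D. real_of_int (l w) / (z - (- 1 / a w)))"
      by (intro sum.cong) (auto simp: field_simps)
    also have "\<dots> = (\<Sum>\<rho>\<in>R. \<Sum>w\<in>{w \<in> ?D. - 1 / a w = \<rho>}. real_of_int (l w) / (z - (- 1 / a w)))"
      unfolding R_def using finite_D by (intro sum.image_gen) simp
    also have "\<dots> = (\<Sum>\<rho>\<in>R. \<mu> \<rho> / (z - \<rho>))"
      unfolding \<mu>_def sum_divide_distrib by (intro sum.cong) auto
    also have "\<dots> = (\<Sum>\<rho>\<in>R. \<mu> \<rho> * (\<Prod>\<sigma>\<in>R - {\<rho>}. z - \<sigma>) / (\<Prod>\<rho>\<in>R. z - \<rho>))"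
    proof (rule sum.cong)
      fix \<rho> assume r: "\<rho> \<in> R"
      then have "(\<Prod>\<rho>\<in>R. z - \<rho>) = (z - \<rho>) * (\<Prod>\<sigma>\<in>R - {\<rho>}. z - \<sigma>)"
        using finite_R by (simp add: prod.remove)
      moreover have "(\<Prod>\<sigma>\<in>R - {\<rho>}. z - \<sigma>) \<noteq> 0" using z finite_R by auto
      ultimately show "\<mu> \<rho> / (z - \<rho>) = \<mu> \<rho> * (\<Prod>\<sigma>\<in>R - {\<rho>}. z - \<sigma>) / (\<Prod>\<rho>\<in>R. z - \<rho>)" by simp
    qed simp
    also have "\<dots> = poly P z / (\<Prod>\<rho>\<in>R. z - \<rho>)"
      by (simp add: P_def poly_sum poly_prod sum_divide_distrib)
    finally show ?thesis .
  qed
  finally show ?thesis .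
qed

text \<open>Otherwise \<open>G\<close> would vanish on an interval around \<open>y0\<close> where no
  form changes sign, and by \<open>Y_continuation\<close> the whole interval would lie in
  \<open>Y\<close>.\<close>

lemma P_nonzero:
  assumes fin: "finite Y" and y0: "y0 \<in> Y"
  shows "P \<noteq> 0"
proof
  assume P0: "P = 0"
  define S where "S = {y. \<forall>w\<in>C. (1 + y * a w) / (1 + y0 * a w) > 0}"
  have "open S"
  proof -
    have "S = (\<Inter>w\<in>C. {y. (1 + y * a w) / (1 + y0 * a w) > 0})" by (auto simp: S_def)
    moreover have "open {y. (1 + y * a w) / (1 + y0 * a w) > 0}" for w
      by (rule open_Collect_less) (auto simp: divide_inverse intro!: continuous_intros)
    ultimately show ?thesis using finite_C by auto
  qed
  moreover have "y0 \<in> S" using Y_nonzero[OF y0] by (simp add: S_def)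
  ultimately obtain e where e: "e > 0" "ball y0 e \<subseteq> S" by (meson openE)
  have notR: "z \<notin> R" if "z \<in> ball y0 e" for z
    using that e D_subset unfolding nonzero_iff_notin_R[symmetric] S_def by fastforce
  have "G y = 0" if y: "y \<in> ball y0 e" for y
  proof -
    have "\<exists>c. \<forall>x\<in>ball y0 e. G x = c"
    proof (rule has_field_derivative_zero_constant)
      show "(G has_field_derivative 0) (at x within ball y0 e)" if "x \<in> ball y0 e" for x
        using G_derivative[OF notR[OF that]] P0 by (simp add: has_field_derivative_at_within)
    qed simp
    then show ?thesis using y G_eq_0[OF y0] e(1) by (metis centre_in_ball)
  qed
  then have "ball y0 e \<subseteq> Y" using Y_continuation[OF y0] e by (fastforce simp: S_def)
  then show False using fin e(1) uncountable_ball countable_finite finite_subset by blast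
qed

lemma degree_P:
  assumes "P \<noteq> 0"
  shows "degree P < card R"
proof -
  have "R \<noteq> {}" using assms by (auto simp: P_def)
  then have c: "card R > 0" using finite_R by auto
  have "degree P \<le> card R - 1"
    unfolding P_def
  proof (rule degree_sum_le[OF finite_R])
    fix \<rho> assume "\<rho> \<in> R"
    have "degree (smult (\<mu> \<rho>) (\<Prod>\<sigma>\<in>R - {\<rho>}. [:- \<sigma>, 1:])) \<le> degree (\<Prod>\<sigma>\<in>R - {\<rho>}. [:- \<sigma>, 1:])"
      by (rule degree_smult_le)
    also have "\<dots> \<le> (\<Sum>\<sigma>\<in>R - {\<rho>}. degree [:- \<sigma>, 1:])"
      using finite_R by (intro degree_prod_sum_le[unfolded o_def]) simp
    also have "\<dots> = card R - 1" using \<open>\<rho> \<in> R\<close> finite_R by simp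
    finally show "degree (smult (\<mu> \<rho>) (\<Prod>\<sigma>\<in>R - {\<rho>}. [:- \<sigma>, 1:])) \<le> card R - 1" .
  qed
  then show ?thesis using c by linarith
qed

text \<open>The form at \<open>w1\<close> is constant and has no root.\<close>

lemma card_R_le: "card R \<le> card D - 1"
proof -
  have "card R \<le> card {w \<in> D. a w \<noteq> 0}" unfolding R_def using finite_D by (intro card_image_le) simp
  also have "\<dots> \<le> card (D - {w1})" using finite_D a_w1 by (intro card_mono) auto
  finally show ?thesis using w1 finite_D by simp
qed

text \<open>For \<open>y\<close> outside \<open>R\<close>, a label of the interval of the complement
  of \<open>R\<close> that contains \<open>y\<close>.\<close>

definition \<kappa> :: "real \<Rightarrow> real set" where "\<kappa> y = {\<rho> \<in> R. \<rho> < y}"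

text \<open>By Rolle, two points of \<open>Y\<close> in the same interval are separated by a root of
  \<open>P\<close>, and \<open>P\<close> has at most \<open>card D - 2\<close> roots.\<close>

lemma card_Y_le:
  assumes fin: "finite Y" and ne: "Y \<noteq> {}"
  shows "card Y \<le> card D - 2 + card (\<kappa> ` Y)"
proof -
  obtain y0 where "y0 \<in> Y" using ne by blast
  then have P: "P \<noteq> 0" using P_nonzero fin by blast
  have "card Y \<le> card {z. poly P z = 0} + card (\<kappa> ` Y)"
  proof (rule card_le_card_separators_plus_classes[OF fin poly_roots_finite[OF P]])
    fix y y' assume y: "y \<in> Y" "y' \<in> Y" "y < y'" "\<kappa> y = \<kappa> y'"
    have notR: "z \<notin> R" if "y \<le> z" "z \<le> y'" for z
    proof
      assume z: "z \<in> R"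
      then have "z < y'" using that Y_notin_R[OF y(2)] by (cases "z = y'") auto
      then have "z \<in> \<kappa> y" using z y(4) by (auto simp: \<kappa>_def)
      then show False using that by (simp add: \<kappa>_def)
    qed
    have "\<exists>z. y < z \<and> z < y' \<and> (G has_real_derivative 0) (at z)"
    proof (rule Rolle)
      show "G y = G y'" using y G_eq_0 by simp
      show "continuous_on {y..y'} G"
        using G_derivative[OF notR] by (intro DERIV_atLeastAtMost_imp_continuous_on) auto
      show "G differentiable at z" if "y < z" "z < y'" for z
        using G_derivative[OF notR[of z]] that by (auto simp: real_differentiable_def)
    qed (use y in auto)
    then obtain z where z: "y < z" "z < y'" "(G has_real_derivative 0) (at z)" by blast
    then have "poly P z / (\<Prod>\<rho>\<in>R. z - \<rho>) = 0"
      using G_derivative[OF notR[of z]] DERIV_unique by fastforce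
    moreover have "(\<Prod>\<rho>\<in>R. z - \<rho>) \<noteq> 0" using notR[of z] z finite_R by auto
    ultimately show "\<exists>z\<in>{z. poly P z = 0}. y < z \<and> z < y'" using z by auto
  next
    fix x y z assume "x \<le> y" "y \<le> z" "\<kappa> x = \<kappa> z"
    moreover have "\<kappa> x \<subseteq> \<kappa> y" if "x \<le> y" for x y using that by (auto simp: \<kappa>_def)
    ultimately show "\<kappa> y = \<kappa> z" by blast
  qed
  also have "card {z. poly P z = 0} \<le> degree P" using P by (rule card_poly_roots_bound)
  finally show ?thesis using degree_P[OF P] card_R_le by linarith
qed

text \<open>The form is the quotient of the monomials at \<open>w\<close> and \<open>w1\<close>, so
  its sign is linear in the difference of their exponents modulo 2.\<close>

lemma negative_iff_dot:
  assumes x: "x \<in> fibre y" and w: "w \<in> C"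
  shows "dot (signs x) (mod2 w - mod2 w1) = (if 1 + y * a w < 0 then 1 else 0)"
proof -
  have nz: "\<And>i. x $ i \<noteq> 0" using x by (simp add: fibre_def)
  have neg: "monomial x w < 0 \<longleftrightarrow> (monomial x w1 < 0 \<longleftrightarrow> \<not> 1 + y * a w < 0)"
    using fibre_monomial[OF x w] fibre_nonzero[OF x w] monomial_nonzero[of x w1] nz
    by (auto simp: mult_less_0_iff)
  have "(dot (signs x) (mod2 w) = 1) = (dot (signs x) (mod2 w1) = 1 \<longleftrightarrow> \<not> 1 + y * a w < 0)"
    using neg by (simp only: monomial_less_0_iff[OF nz])
  then show ?thesis unfolding dot_simps
    by (cases "dot (signs x) (mod2 w)"; cases "dot (signs x) (mod2 w1)") (auto split: if_splits)
qed

text \<open>Between consecutive classes some linear form changes sign. The differences of consecutive sign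
  vectors are then dual functionals to the mod 2 reductions of the exponents of these forms, which
  are therefore linearly independent.\<close>

lemma card_classes_le:
  assumes fin: "finite Y" and ne: "Y \<noteq> {}"
  shows "card (\<kappa> ` Y) \<le> rk_mod2 C + 1" "card (\<kappa> ` Y) \<le> card D - 1"
proof -
  \<comment> \<open>One representative per interval. Each one except the smallest is paired with its
    predecessor \<open>p y\<close> and with a form \<open>\<omega> y\<close> whose root lies between
    them.\<close>
  obtain Y0 where Y0: "Y0 \<subseteq> Y" "inj_on \<kappa> Y0" "\<kappa> ` Y = \<kappa> ` Y0"
    using subset_image_inj[of "\<kappa> ` Y" \<kappa> Y] by auto
  have fin0: "finite Y0" using Y0(1) fin finite_subset by blast
  have ne0: "Y0 \<noteq> {}" using Y0(3) ne by blast
  define I where "I = Y0 - {Min Y0}"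
  have finI: "finite I" using fin0 by (simp add: I_def)
  have cI: "card (\<kappa> ` Y) = card I + 1"
    unfolding Y0(3) card_image[OF Y0(2)] using card_Suc_Diff1[OF fin0 Min_in[OF fin0 ne0]] by (simp add: I_def)
  define p where "p y = Max {y' \<in> Y0. y' < y}" for y
  have p: "p y \<in> Y0" "p y < y" "\<And>y'. y' \<in> Y0 \<Longrightarrow> y' < y \<Longrightarrow> y' \<le> p y" if y: "y \<in> I" for y
  proof -
    have "Min Y0 \<in> {y' \<in> Y0. y' < y}"
      using y fin0 Min_in[OF fin0 ne0] Min_le[OF fin0, of y] by (auto simp: I_def less_le)
    then have "p y \<in> {y' \<in> Y0. y' < y}" unfolding p_def using fin0 by (intro Max_in) auto
    then show "p y \<in> Y0" "p y < y" by auto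
    show "y' \<le> p y" if "y' \<in> Y0" "y' < y" for y'
      unfolding p_def using that fin0 by (intro Max_ge) auto
  qed
  have "\<exists>w. w \<in> D \<and> a w \<noteq> 0 \<and> p y < - 1 / a w \<and> - 1 / a w < y" if y: "y \<in> I" for y
  proof -
    have yY: "y \<in> Y0" "p y \<in> Y0" using y p by (auto simp: I_def)
    have "\<kappa> (p y) \<noteq> \<kappa> y" using Y0(2) yY p(2)[OF y] by (auto dest: inj_onD)
    then obtain \<rho> where r: "\<rho> \<in> R" "p y \<le> \<rho>" "\<rho> < y" using p(2)[OF y] by (force simp: \<kappa>_def)
    moreover have "p y \<noteq> \<rho>" using Y_notin_R[of "p y"] yY Y0(1) r by blast
    ultimately show ?thesis by (force simp: R_def)
  qed
  then obtain \<omega> where om: "\<And>y. y \<in> I \<Longrightarrow> \<omega> y \<in> D" "\<And>y. y \<in> I \<Longrightarrow> a (\<omega> y) \<noteq> 0"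
    "\<And>y. y \<in> I \<Longrightarrow> p y < - 1 / a (\<omega> y)" "\<And>y. y \<in> I \<Longrightarrow> - 1 / a (\<omega> y) < y"
    by metis
  define X where "X y = (SOME x. x \<in> fibre y)" for y
  have X: "X y \<in> fibre y" if "y \<in> Y0" for y using that Y0(1) unfolding X_def Y_def by (auto simp: some_in_eq)
  define v where "v y = mod2 (\<omega> y) - mod2 w1" for y
  define \<phi> where "\<phi> y = signs (X y) - signs (X (p y))" for y
  \<comment> \<open>The form at \<open>\<omega> j\<close> changes sign only at its root, between
    \<open>p j\<close> and \<open>j\<close>; every other consecutive pair lies on one side of that
    root.\<close>
  have dual: "dot (\<phi> i) (v j) = (if i = j then 1 else 0)" if i: "i \<in> I" and j: "j \<in> I" for i j
  proof -
    have iY: "i \<in> Y0" "j \<in> Y0" using i j by (auto simp: I_def)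
    have wC: "\<omega> j \<in> C" using om(1)[OF j] D_subset by blast
    have nz: "1 + i * a (\<omega> j) \<noteq> 0" "1 + p i * a (\<omega> j) \<noteq> 0"
      using Y_nonzero wC iY p(1)[OF i] Y0(1) by blast+
    have val: "dot (\<phi> i) (v j) = (if 1 + i * a (\<omega> j) < 0 then 1 else 0) - (if 1 + p i * a (\<omega> j) < 0 then 1 else 0)"
      unfolding \<phi>_def v_def dot_simps(5)
      by (simp only: negative_iff_dot[OF X[OF iY(1)] wC] negative_iff_dot[OF X[OF p(1)[OF i]] wC])
    show ?thesis
    proof (cases "i = j")
      case True
      have "1 + p i * a (\<omega> j) < 0 \<longleftrightarrow> \<not> 1 + i * a (\<omega> j) < 0"
        using opposite_sign_linear om(2-4)[OF i] True by blast
      then show ?thesis unfolding val using True by (auto simp: diff_eq_eq)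
    next
      case False
      have "i < - 1 / a (\<omega> j) \<longleftrightarrow> p i < - 1 / a (\<omega> j)"
      proof (cases "i < j")
        case True
        then have "i \<le> p j" using p(3)[OF j] iY by blast
        then show ?thesis using om(3)[OF j] p(2)[OF i] by linarith
      next
        case False
        then have "j \<le> p i" using p(3)[OF i] iY \<open>i \<noteq> j\<close> by force
        then show ?thesis using om(4)[OF j] p(2)[OF i] by linarith
      qed
      then have "1 + i * a (\<omega> j) < 0 \<longleftrightarrow> 1 + p i * a (\<omega> j) < 0"
        using same_sign_linear om(2)[OF j] nz by blast
      then show ?thesis unfolding val using False by simp
    qed
  qed
  note indep = independent_of_dual_functionals[OF finI dual]
  have "v ` I \<subseteq> (\<lambda>w. mod2 w - mod2 w1) ` C" using om(1) D_subset by (auto simp: v_def)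
  then have "card (v ` I) \<le> rk_mod2 C"
    unfolding rk_mod2_eq[OF w1_C] using indep(2) by (rule vec.independent_card_le_dim)
  then show "card (\<kappa> ` Y) \<le> rk_mod2 C + 1" using cI card_image[OF indep(1)] by simp
  have inj: "inj_on \<omega> I"
    using indep(1) unfolding inj_on_def v_def by metis
  have im: "\<omega> ` I \<subseteq> D - {w1}" using om(1,2) a_w1 by auto
  \<comment> \<open>Improves the count by one: if every point of \<open>D - {w1}\<close> were some
    \<open>\<omega> i\<close>, pairing the relation modulo 2 with \<open>\<phi> i\<close> would make
    all its coefficients there even, and the zero sum would make \<open>l w1\<close> even
    too.\<close>
  have "card I \<noteq> card (D - {w1})"
  proof
    assume "card I = card (D - {w1})"
    then have eq: "\<omega> ` I = D - {w1}"
      using im finite_D card_image[OF inj] by (intro card_subset_eq) auto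
    have even: "even (l w)" if w: "w \<in> D - {w1}" for w
    proof -
      obtain i where i: "i \<in> I" "w = \<omega> i" using w eq by blast
      have "(\<Sum>w\<in>C. of_int (l w) *s (mod2 w - mod2 w1)) = 0"
      proof -
        have "(\<Sum>w\<in>C. of_int (l w) *s (mod2 w - mod2 w1)) $ k
            = of_int ((\<Sum>w\<in>C. l w * w $ k) - (\<Sum>w\<in>C. l w) * w1 $ k)" for k
          by (simp add: mod2_def right_diff_distrib sum_subtractf sum_distrib_right)
        then show ?thesis by (simp add: vec_eq_iff sum_l sum_l_nth)
      qed
      then have "0 = dot (\<phi> i) (\<Sum>w\<in>C. of_int (l w) *s (mod2 w - mod2 w1))" by (simp add: dot_simps)
      also have "\<dots> = (\<Sum>w\<in>C. of_int (l w) * dot (\<phi> i) (mod2 w - mod2 w1))"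
        by (simp only: dot_sum dot_simps(4))
      also have "\<dots> = (\<Sum>w\<in>\<omega> ` I. of_int (l w) * dot (\<phi> i) (mod2 w - mod2 w1))"
        unfolding eq using finite_C by (intro sum.mono_neutral_right) (auto simp: D_def dot_simps(1))
      also have "\<dots> = (\<Sum>j\<in>I. of_int (l (\<omega> j)) * dot (\<phi> i) (v j))"
        by (simp add: sum.reindex[OF inj] v_def)
      also have "\<dots> = (\<Sum>j\<in>I. if i = j then of_int (l (\<omega> j)) else 0)"
        by (rule sum.cong) (use i dual in auto)
      also have "\<dots> = of_int (l w)" using i finI by simp
      finally show ?thesis by (simp add: of_int_bit split: if_splits)
    qed
    have ev: "even (l w)" if "w \<in> C - {w1}" for w
      using even[of w] that by (cases "w \<in> D") (auto simp: D_def)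
    then have "even (\<Sum>w\<in>C - {w1}. l w)" by (rule dvd_sum)
    moreover have "l w1 + (\<Sum>w\<in>C - {w1}. l w) = 0"
      using sum_l sum.remove[OF finite_C w1_C, of l] by simp
    ultimately have "even (l w1)" by presburger
    then show False using ev odd_l by blast
  qed
  moreover have "card I \<le> card (D - {w1})"
    using im finite_D card_image[OF inj] card_mono[of "D - {w1}" "\<omega> ` I"] by simp
  ultimately show "card (\<kappa> ` Y) \<le> card D - 1" using cI w1 finite_D by simp
qed

text \<open>Each fibre contributes at most the power of 2. The number of fibres combines
  \<open>card_Y_le\<close> with both bounds of \<open>card_classes_le\<close>, using that
  \<open>card D\<close> is at most \<open>m_circ C + 2\<close>.\<close>

lemma card_Union_fibre_le:
  assumes fin: "finite (\<Union>y. fibre y)"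
  shows "card (\<Union>y. fibre y) \<le> 2 ^ (CARD('n) - rk_mod2 C) * (m_circ C + min (m_circ C) (rk_mod2 C) + 1)"
proof -
  have bound: "card (\<Union>y\<in>A. fibre y) \<le> card A * 2 ^ (CARD('n) - rk_mod2 C)" if "finite A" for A
  proof -
    have "card (\<Union>y\<in>A. fibre y) \<le> (\<Sum>y\<in>A. card (fibre y))" using that by (rule card_UN_le)
    also have "\<dots> \<le> (\<Sum>y\<in>A. 2 ^ (CARD('n) - rk_mod2 C))" by (intro sum_mono fibre_card_le)
    finally show ?thesis by simp
  qed
  have "\<exists>A. finite A \<and> (\<Union>y. fibre y) = (\<Union>y\<in>A. fibre y) \<and> card A \<le> m_circ C + min (m_circ C) (rk_mod2 C) + 1"
  proof (cases "\<exists>w\<in>C. a w \<noteq> 0")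
    case True
    then have finY: "finite Y" using finite_Y[OF fin] by blast
    have "card Y \<le> m_circ C + min (m_circ C) (rk_mod2 C) + 1"
    proof (cases "Y = {}")
      case False
      have "card D > 0" using w1 finite_D by (auto simp: card_gt_0_iff)
      moreover have "card (\<kappa> ` Y) > 0" using False finY by (auto simp: card_gt_0_iff)
      ultimately show ?thesis
        using card_Y_le[OF finY False] card_classes_le[OF finY False] card_D_le by linarith
    qed simp
    moreover have "(\<Union>y. fibre y) = (\<Union>y\<in>Y. fibre y)" by (auto simp: Y_def)
    ultimately show ?thesis using finY by blast
  next
    case False
    \<comment> \<open>All forms are constantly 1 on \<open>C\<close>, so a single parameter
      suffices.\<close>
    then have "fibre y = fibre 0" for y by (auto simp: fibre_def)
    then show ?thesis by (intro exI[of _ "{0}"]) auto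
  qed
  then obtain A where A: "finite A" "(\<Union>y. fibre y) = (\<Union>y\<in>A. fibre y)"
    "card A \<le> m_circ C + min (m_circ C) (rk_mod2 C) + 1" by blast
  have "card (\<Union>y. fibre y) \<le> card A * 2 ^ (CARD('n) - rk_mod2 C)" using bound[OF A(1)] A(2) by simp
  also have "\<dots> \<le> (m_circ C + min (m_circ C) (rk_mod2 C) + 1) * 2 ^ (CARD('n) - rk_mod2 C)"
    using A(3) by (rule mult_le_mono1)
  finally show ?thesis by (simp add: mult.commute)
qed

end

section \<open>The bound\<close>

context circuit_relation
begin

text \<open>If the coefficient matrix had rank below \<open>n\<close>, a solution would not be isolated over the
  complex numbers; finiteness thus forces the kernel into a plane.\<close>

lemma card_real_solutions_le:
  fixes c :: "'n \<Rightarrow> int ^ 'n \<Rightarrow> real"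
  assumes fin: "finite (torus_solutions c C :: (complex ^ 'n) set)"
  shows "card (torus_solutions c C :: (real ^ 'n) set)
    \<le> 2 ^ (CARD('n) - rk_mod2 C) * (m_circ C + min (m_circ C) (rk_mod2 C) + 1)"
proof (cases "torus_solutions c C = ({} :: (real ^ 'n) set)")
  case False
  then obtain x0 :: "real ^ 'n" where x0: "x0 \<in> torus_solutions c C" by blast
  have x0nz: "\<And>i. x0 $ i \<noteq> 0" and x0sol: "\<And>j. (\<Sum>w\<in>C. c j w * monomial x0 w) = 0"
    using x0 by (auto simp: torus_solutions_def laurent_eval_monomial)
  \<comment> \<open>The kernel of the coefficient matrix with columns scaled by the monomials of
    \<open>x0\<close>. Since \<open>x0\<close> is a solution, it contains the constants.\<close>
  define K where "K d \<longleftrightarrow> (\<forall>j. (\<Sum>w\<in>C. c j w * monomial x0 w * d w) = 0)" for d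
  have "\<exists>a. K a \<and> (\<forall>d. K d \<longrightarrow> (\<exists>\<alpha> \<beta>. \<forall>w\<in>C. d w = \<alpha> + \<beta> * a w))"
  proof (rule ccontr)
    assume none: "\<not> ?thesis"
    have ex: "\<exists>d. K d \<and> (\<forall>\<alpha> \<beta>. \<not> (\<forall>w\<in>C. d w = \<alpha> + \<beta> * a w))" if "K a" for a
      using none that by auto
    have "K (\<lambda>_. 0)" by (simp add: K_def)
    from ex[OF this] obtain u where u: "K u" "\<And>\<alpha>. \<not> (\<forall>w\<in>C. u w = \<alpha>)" by auto
    from ex[OF u(1)] obtain v where v: "K v" "\<And>\<alpha> \<beta>. \<not> (\<forall>w\<in>C. v w = \<alpha> + \<beta> * u w)" by auto
    have indep: "\<alpha> = 0 \<and> \<beta> = 0 \<and> \<gamma> = 0" if eq: "\<forall>w\<in>C. \<alpha> + \<beta> * u w + \<gamma> * v w = 0" for \<alpha> \<beta> \<gamma>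
    proof -
      have "\<gamma> = 0"
      proof (rule ccontr)
        assume g: "\<gamma> \<noteq> 0"
        have "\<forall>w\<in>C. v w = - \<alpha> / \<gamma> + (- \<beta> / \<gamma>) * u w"
        proof
          fix w assume w: "w \<in> C"
          have "\<gamma> * (- \<alpha> / \<gamma> + (- \<beta> / \<gamma>) * u w) = - \<alpha> - \<beta> * u w"
            using g by (simp add: field_simps)
          also have "\<dots> = \<gamma> * v w" using bspec[OF eq w] by linarith
          finally show "v w = - \<alpha> / \<gamma> + (- \<beta> / \<gamma>) * u w" using g by simp
        qed
        then show False using v(2) by blast
      qed
      moreover have "\<beta> = 0"
      proof (rule ccontr)
        assume b: "\<beta> \<noteq> 0"
        have "\<forall>w\<in>C. u w = - \<alpha> / \<beta>"
        proof
          fix w assume w: "w \<in> C"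
          have "\<beta> * u w = - \<alpha>" using bspec[OF eq w] \<open>\<gamma> = 0\<close> by simp
          then show "u w = - \<alpha> / \<beta>" using b by (simp add: field_simps)
        qed
        then show False using u(2) by blast
      qed
      moreover obtain w where "w \<in> C" using D_nonempty D_subset by blast
      ultimately show ?thesis using bspec[OF eq] by simp
    qed
    have "\<And>j. (\<Sum>w\<in>C. c j w * monomial x0 w * u w) = 0" "\<And>j. (\<Sum>w\<in>C. c j w * monomial x0 w * v w) = 0"
      using u(1) v(1) by (simp_all add: K_def)
    from infinite_complex_solutions[OF x0 this indep] fin show False by blast
  qed
  then obtain a where a: "K a" "\<And>d. K d \<Longrightarrow> \<exists>\<alpha> \<beta>. \<forall>w\<in>C. d w = \<alpha> + \<beta> * a w" by blast
  obtain w1 where w1: "w1 \<in> D" using D_nonempty by blast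
  \<comment> \<open>Subtracting a constant changes neither the span of 1 and \<open>a\<close> nor
    the kernel, and achieves the normalisation at \<open>w1\<close>.\<close>
  interpret circuit_pencil C l "\<lambda>w. a w - a w1" w1
    by unfold_locales (use w1 in auto)
  define \<Phi> where "\<Phi> x = (\<chi> i. x $ i / x0 $ i)" for x :: "real ^ 'n"
  have inj: "inj_on \<Phi> A" for A using x0nz by (auto simp: inj_on_def \<Phi>_def vec_eq_iff)
  have image: "\<Phi> ` torus_solutions c C = (\<Union>y. fibre y)"
  proof
    show "\<Phi> ` torus_solutions c C \<subseteq> (\<Union>y. fibre y)"
    proof clarify
      fix x :: "real ^ 'n" assume x: "x \<in> torus_solutions c C"
      have xnz: "\<Phi> x $ i \<noteq> 0" for i using x x0nz by (simp add: torus_solutions_def \<Phi>_def)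
      have "K (monomial (\<Phi> x))"
        using x monomial_nonzero[OF x0nz]
        by (simp add: K_def \<Phi>_def monomial_divide torus_solutions_def laurent_eval_monomial)
      then obtain \<alpha> \<beta> where ab: "\<forall>w\<in>C. monomial (\<Phi> x) w = \<alpha> + \<beta> * a w" using a(2) by blast
      \<comment> \<open>The monomial at \<open>w1\<close>. It is nonzero, so the affine parameter
        \<open>\<beta> / k\<close> exists.\<close>
      define k where "k = \<alpha> + \<beta> * a w1"
      have "k \<noteq> 0" using ab w1_C monomial_nonzero[OF xnz, of w1] by (simp add: k_def)
      then have "\<forall>w\<in>C. monomial (\<Phi> x) w = k * (1 + (\<beta> / k) * (a w - a w1))"
        using ab by (simp add: distrib_left) (simp add: k_def algebra_simps)
      then have "\<Phi> x \<in> fibre (\<beta> / k)" using xnz by (auto simp: fibre_def)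
      then show "\<Phi> x \<in> (\<Union>y. fibre y)" by blast
    qed
    show "(\<Union>y. fibre y) \<subseteq> \<Phi> ` torus_solutions c C"
    proof clarify
      fix y x assume "x \<in> fibre y"
      then obtain k where xnz: "\<And>i. x $ i \<noteq> 0" and k: "\<And>w. w \<in> C \<Longrightarrow> monomial x w = k * (1 + y * (a w - a w1))"
        by (auto simp: fibre_def)
      define z where "z = (\<chi> i. x0 $ i * x $ i)"
      have "laurent_eval (c j) C z = 0" for j
      proof -
        have "laurent_eval (c j) C z = (\<Sum>w\<in>C. c j w * (monomial x0 w * (k * (1 + y * (a w - a w1)))))"
          by (simp add: laurent_eval_monomial z_def monomial_mult k)
        also have "\<dots> = k * (1 - y * a w1) * (\<Sum>w\<in>C. c j w * monomial x0 w) + k * y * (\<Sum>w\<in>C. c j w * monomial x0 w * a w)"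
          by (simp add: sum_distrib_left algebra_simps flip: sum.distrib)
        finally show ?thesis using x0sol a(1) by (simp add: K_def)
      qed
      then have "z \<in> torus_solutions c C" using xnz x0nz by (simp add: torus_solutions_def z_def)
      moreover have "x = \<Phi> z" using x0nz by (simp add: \<Phi>_def z_def vec_eq_iff)
      ultimately show "x \<in> \<Phi> ` torus_solutions c C" by blast
    qed
  qed
  have "finite (torus_solutions c C :: (real ^ 'n) set)"
  proof (rule inj_on_finite[OF _ _ fin])
    let ?f = "\<lambda>x :: real ^ 'n. \<chi> i. complex_of_real (x $ i)"
    show "inj_on ?f (torus_solutions c C)" by (auto simp: inj_on_def vec_eq_iff)
    have "laurent_eval d C (?f x) = of_real (laurent_eval d C x)" for d x
      by (simp add: laurent_eval_monomial monomial_of_real)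
    then show "?f ` torus_solutions c C \<subseteq> torus_solutions c C" by (auto simp: torus_solutions_def)
  qed
  then have "finite (\<Union>y. fibre y)" unfolding image[symmetric] by (rule finite_imageI)
  from card_Union_fibre_le[OF this] show ?thesis
    unfolding image[symmetric] by (simp add: card_image[OF inj])
qed simp

end

theorem theorem2p2:
  fixes C :: "(int ^ 'n::finite) set"
    and c :: "'n \<Rightarrow> int ^ 'n \<Rightarrow> real"
  assumes "is_circuit C"
    and "supported_on c C"
    and "generic_system c C"
  defines "N \<equiv> card (torus_solutions c C :: (real ^ 'n) set)"
  shows "(rk_mod2 C \<le> m_circ C \<longrightarrow>
            real N \<le> 2 ^ (CARD('n) - rk_mod2 C) * real (m_circ C + rk_mod2 C + 1))
       \<and> (rk_mod2 C \<ge> m_circ C \<longrightarrow>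
            real N \<le> 2 ^ (CARD('n) - rk_mod2 C) * real (2 * m_circ C + 1))"
proof -
  obtain l where "circuit_relation C l" using circuit_relation_exists[OF assms(1)] by blast
  then interpret circuit_relation C l .
  \<comment> \<open>The minimum covers both cases of the claim at once.\<close>
  have "N \<le> 2 ^ (CARD('n) - rk_mod2 C) * (m_circ C + min (m_circ C) (rk_mod2 C) + 1)"
    unfolding N_def using assms(3) by (intro card_real_solutions_le) (simp add: generic_system_def)
  then have "real N \<le> 2 ^ (CARD('n) - rk_mod2 C) * real (m_circ C + min (m_circ C) (rk_mod2 C) + 1)"
    by (metis of_nat_le_iff of_nat_mult of_nat_numeral of_nat_power)
  note N = this
  show ?thesis
  proof (intro conjI impI)
    assume "rk_mod2 C \<le> m_circ C"
    then show "real N \<le> 2 ^ (CARD('n) - rk_mod2 C) * real (m_circ C + rk_mod2 C + 1)"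
      using N by (simp only: min_absorb2)
  next
    assume "rk_mod2 C \<ge> m_circ C"
    then show "real N \<le> 2 ^ (CARD('n) - rk_mod2 C) * real (2 * m_circ C + 1)"
      using N by (simp only: min_absorb1 mult_2)
  qed
qed

end
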